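(* Let $\kappa>0$ and let $F_S$ be a service time distribution with unit mean and $F_S(0)=0$. Consider the erasure queue-channel with erasure probability $p(W)=1-\exp(-\kappa W)$, Poisson arrivals of rate $\lambda\in(0,1)$ (interarrival distribution $F_A(x)=1-\exp(-\lambda x)$) and service distribution $F_S$. Then, over $\lambda\in(0,1)$, the capacity is maximized at $$\lambda_{\mathsf{M}/\mathsf{GI}/1}=\frac{1}{\alpha}\left(1-\sqrt{1-\alpha}\right),\qquad \alpha=\frac{1-\tilde F_S(\kappa)}{\kappa},$$ where $\tilde F_S(u)=\int \exp(-ux)\,dF_S(x)$.
   Context: Queue. Symbols (qubits) $j=1,2,\dots$ arrive at a single-server FIFO queue. Interarrival times are i.i.d. with distribution $F_A$; service times $S_j$ are i.i.d. with distribution $F_S$ on $[0,\infty)$, independent of the arrivals. The first symbol arrives to an empty system. $A_j$ is the arrival time of symbol $j$, $D_j$ is the time it leaves the waiting line (its service start), and $W_j=D_j-A_j$ is its waiting time. Thus $W_1=0$ and $W_{j+1}=\max(W_j+S_j-(A_{j+1}-A_j),0)$. Channel. The input alphabet $\mathcal{X}$ is finite with $|\mathcal{X}|\ge2$. The inputs $X^n=(X_1,\dots,X_n)\in\mathcal{X}^n$ are independent of the arrival and service times. Given $X^n$ and all arrival and service times, the outputs $Y_1,\dots,Y_n$ are independent, with $Y_j=X_j$ with probability $1-p(W_j)$ and $Y_j=\mathcal{E}$ (an erasure symbol not in $\mathcal{X}$) with probability $p(W_j)$. Capacity (bits/sec). An $(n,\tilde R,T)$ code consists of a message set $\mathcal{M}$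 with $|\mathcal{M}|=2^{n\tilde R}$, an encoder $X^n=f(M)$ and a decoder $\hat M=g(\cdot)$ acting on $(Y^n,A^n,D^n)$ if the receiver knows the arrival and departure times, and on $Y^n$ only if it does not (the claim is meant in either case); $M$ is uniform on $\mathcal{M}$ and the expected time by which all $n$ symbols have been served is less than $T$. A rate $R$ is achievable if for all $\epsilon\in(0,1)$ and $\delta>0$, for all sufficiently large $n$ there is an $(n,\tilde R,T)$ code with $\Pr[\hat M\ne M]<\epsilon$ and $n\tilde R/T>R-\delta$. The capacity is the supremum of achievable rates. *)

theory Defs
  imports "HOL-Probability.Probability"
begin

text \<open>
  Symbols are numbered from 0. The functions below act on the sequence \<open>t\<close> of interarrival times
  (\<open>t 0\<close> being the time until the first arrival) and the sequence \<open>s\<close> of service times.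
\<close>

definition arrival :: "(nat \<Rightarrow> real) \<Rightarrow> nat \<Rightarrow> real" where
  "arrival t j = (\<Sum>i\<le>j. t i)"

text \<open>
  The time at which symbol \<open>j\<close> leaves the waiting line: the first symbol finds the system empty,
  and symbol \<open>j + 1\<close> starts service once it has arrived and symbol \<open>j\<close> has been served.
\<close>

primrec service_start :: "(nat \<Rightarrow> real) \<Rightarrow> (nat \<Rightarrow> real) \<Rightarrow> nat \<Rightarrow> real" where
  "service_start t s 0 = arrival t 0"
| "service_start t s (Suc j) = max (arrival t (Suc j)) (service_start t s j + s j)"

definition waiting :: "(nat \<Rightarrow> real) \<Rightarrow> (nat \<Rightarrow> real) \<Rightarrow> nat \<Rightarrow> real" where
  "waiting t s j = service_start t s j - arrival t j"

lemma waiting_0: "waiting t s 0 = 0"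
  by (simp add: waiting_def)

lemma waiting_Suc:
  "waiting t s (Suc j) = max (waiting t s j + s j - (arrival t (Suc j) - arrival t j)) 0"
  by (simp add: waiting_def max_def)

text \<open>The joint law of the i.i.d. interarrival times and the independent i.i.d. service times.\<close>

definition timing :: "real measure \<Rightarrow> real measure \<Rightarrow> ((nat \<Rightarrow> real) \<times> (nat \<Rightarrow> real)) measure" where
  "timing FA FS = (\<Pi>\<^sub>M j\<in>UNIV. FA) \<Otimes>\<^sub>M (\<Pi>\<^sub>M j\<in>UNIV. FS)"

text \<open>
  The conditional law of the outputs given the input word \<open>x\<close> and the waiting times \<open>w\<close>; an erasure
  is \<open>None\<close>. Output words are padded with \<open>None\<close> from position \<open>n\<close> on.
\<close>

definition channel_pmf ::
    "(real \<Rightarrow> real) \<Rightarrow> nat \<Rightarrow> (nat \<Rightarrow> real) \<Rightarrow> (nat \<Rightarrow> 'x) \<Rightarrow> (nat \<Rightarrow> 'x option) pmf" where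
  "channel_pmf p n w x =
     Pi_pmf {..<n} None
       (\<lambda>j. map_pmf (\<lambda>erased. if erased then None else Some (x j)) (bernoulli_pmf (p (w j))))"

type_synonym 'x encoder = "nat \<Rightarrow> nat \<Rightarrow> 'x"
type_synonym 'x decoder = "(nat \<Rightarrow> 'x option) \<Rightarrow> (nat \<Rightarrow> real) \<times> (nat \<Rightarrow> real) \<Rightarrow> nat"

text \<open>
  An \<open>(n, R', T)\<close> code with message set \<open>M\<close>, encoder \<open>f\<close> and decoder \<open>g\<close>. The decoder's second
  argument is the pair of words of arrival times and of departure times from the waiting line; if
  \<open>informed\<close> is false, the decoder must ignore it. As service is FIFO, all \<open>n\<close> symbols have been
  served once the last one has. The expectation is taken in \<^typ>\<open>ennreal\<close> because the Bochner
  integral of a function that is not integrable is 0.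
\<close>

definition is_code ::
    "bool \<Rightarrow> 'x set \<Rightarrow> real measure \<Rightarrow> real measure \<Rightarrow> nat \<Rightarrow> real \<Rightarrow> real
       \<Rightarrow> nat set \<Rightarrow> 'x encoder \<Rightarrow> 'x decoder \<Rightarrow> bool" where
  "is_code informed X FA FS n R' T M f g \<longleftrightarrow>
     0 < n \<and>
     finite M \<and> real (card M) = 2 powr (real n * R') \<and>
     (\<forall>m\<in>M. \<forall>j<n. f m j \<in> X) \<and>
     (\<forall>y. g y \<in> (\<Pi>\<^sub>M j\<in>{..<n}. borel) \<Otimes>\<^sub>M (\<Pi>\<^sub>M j\<in>{..<n}. borel) \<rightarrow>\<^sub>M count_space M) \<and>
     (informed \<or> (\<forall>y v v'. g y v = g y v')) \<and>
     (\<integral>\<^sup>+ (t, s). ennreal (service_start t s (n - 1) + s (n - 1)) \<partial>timing FA FS) < ennreal T"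

text \<open>
  The probability that the decoded message differs from the uniformly distributed message, computed
  by conditioning on the arrival and service times, of which the message is independent.
\<close>

definition error_prob ::
    "(real \<Rightarrow> real) \<Rightarrow> real measure \<Rightarrow> real measure \<Rightarrow> nat
       \<Rightarrow> nat set \<Rightarrow> 'x encoder \<Rightarrow> 'x decoder \<Rightarrow> real" where
  "error_prob p FA FS n M f g =
     (\<integral>(t, s).
        measure_pmf.prob
          (bind_pmf (pmf_of_set M) (\<lambda>m.
             map_pmf (\<lambda>y. (m, g y (restrict (arrival t) {..<n}, restrict (service_start t s) {..<n})))
               (channel_pmf p n (waiting t s) (f m))))
          {(m, m'). m' \<noteq> m}
      \<partial>timing FA FS)"

definition achievable ::
    "bool \<Rightarrow> 'x set \<Rightarrow> (real \<Rightarrow> real) \<Rightarrow> real measure \<Rightarrow> real measure \<Rightarrow> real \<Rightarrow> bool" where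
  "achievable informed X p FA FS R \<longleftrightarrow>
     (\<forall>\<epsilon>\<in>{0<..<1}. \<forall>\<delta>>0. \<forall>\<^sub>F n in sequentially.
        \<exists>R' T M f g. is_code informed X FA FS n R' T M f g \<and>
          error_prob p FA FS n M f g < \<epsilon> \<and> real n * R' / T > R - \<delta>)"

text \<open>The supremum is taken in \<^typ>\<open>ereal\<close>, where it always exists.\<close>

definition capacity ::
    "bool \<Rightarrow> 'x set \<Rightarrow> (real \<Rightarrow> real) \<Rightarrow> real measure \<Rightarrow> real measure \<Rightarrow> ereal" where
  "capacity informed X p FA FS = (SUP R\<in>{R. achievable informed X p FA FS R}. ereal R)"

abbreviation exponential_distribution :: "real \<Rightarrow> real measure" where
  "exponential_distribution l \<equiv> density lborel (\<lambda>x. ennreal (exponential_density l x))"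

definition laplace_transform :: "real measure \<Rightarrow> real \<Rightarrow> real" where
  "laplace_transform F u = (\<integral>x. exp (- u * x) \<partial>F)"

end

theory Submission
  imports Defs
begin

text \<open>
  In the queue with arrival rate \<open>l\<close> put \<open>h(w) = (\<kappa> - l) exp(- \<kappa> w) - \<kappa> l w\<close>. For exponential interarrival
  times the conditional mean of \<open>h(W_(j+1))\<close> given \<open>W_j = w\<close> equals
  \<open>h(w) - \<kappa> (1 - l \<alpha>) (exp(- \<kappa> w) - q)\<close> with \<open>q = (1 - l) / (1 - l \<alpha>)\<close>. Summing over \<open>j < n\<close>, the
  average of \<open>exp(- \<kappa> W_j)\<close> differs from \<open>q\<close> by a martingale over \<open>n\<close> and by \<open>h(W_n) / n\<close>. Both vanish in
  mean; as service times only have a first moment, they are truncated, and the queue with truncated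
  service times has \<open>E W_n^2 = O(n)\<close> by its negative drift.

  Hence about \<open>n q\<close> of \<open>n\<close> symbols survive, in a time of about \<open>n / l\<close>. A decoder that sees \<open>k\<close> unerased
  symbols is right for at most \<open>|X|^k\<close> messages, whether or not it knows the timing, while a code
  picked greedily, decoded without the timing, has average error at most
  \<open>P(k < k0) + |M| |X|^(-k0)\<close>. So the capacity is \<open>l q log |X|\<close>.
  With \<open>\<alpha> = 1 - r^2\<close> the optimality of \<open>l = 1 / (1 + r)\<close> is the identity
  \<open>(1 - l \<alpha>) - l (1 - l) (1 + r)^2 = ((1 - l) - l r)^2\<close>.
\<close>

section \<open>Resampling a coordinate of the timing law\<close>

text \<open>No filtration, conditional expectation, stationary law or ergodic theorem appears. The
  obstacle of speaking about the past of the queue is met by resampling: overwriting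
  \<open>t (Suc n)\<close> and \<open>s n\<close> by a fresh independent pair preserves
  \<open>timing\<close>, while the waiting time of symbol \<open>n\<close> sees neither, so
  integrating the fresh pair first is conditioning on the past. The second moments along the queue
  are bounded this way by induction on \<open>n\<close>, as nonnegative integrals, so that nothing
  need be known integrable in advance. The two halves of the capacity proof use different
  information on the number \<open>k\<close> of survivors. The converse needs only its mean, since
  the fraction of messages decoded correctly is bounded by a function linear in \<open>k\<close>.
  Achievability needs concentration, in two layers: given the timing, \<open>k\<close> has variance
  at most \<open>n\<close>; its conditional mean, a sum of \<open>exp (- \<kappa> * W j)\<close>, is
  close to \<open>n * survival\<close> in L1.\<close>

text \<open>Independence in the form used below: a coordinate may be replaced by a fresh draw. On a
  cylinder set the fresh draw contributes exactly the factor that the old coordinate loses, and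
  cylinders determine the product measure.\<close>

lemma distr_PiM_fun_upd:
  fixes F :: "'a measure" and i :: 'i
  assumes F: "prob_space F"
  shows "distr ((\<Pi>\<^sub>M j\<in>(UNIV :: 'i set). F) \<Otimes>\<^sub>M F) (\<Pi>\<^sub>M j\<in>UNIV. F) (\<lambda>(t, x). t(i := x))
    = (\<Pi>\<^sub>M j\<in>UNIV. F)" (is "distr (?P \<Otimes>\<^sub>M F) ?P ?u = ?P")
proof -
  interpret F: prob_space F by fact
  interpret product_prob_space "\<lambda>_. F" "UNIV :: 'i set" by unfold_locales
  interpret PF: pair_prob_space ?P F by unfold_locales
  have u[measurable]: "?u \<in> measurable (?P \<Otimes>\<^sub>M F) ?P"
    by (rule measurable_PiM_single') (auto simp: space_pair_measure space_PiM split_beta')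
  interpret D: prob_space "distr (?P \<Otimes>\<^sub>M F) ?P ?u"
    by (rule PF.prob_space_distr) measurable
  show ?thesis
  proof (rule PiM_eq)
    fix J :: "'i set" and A :: "'i \<Rightarrow> 'a set"
    assume J: "finite J" "J \<subseteq> UNIV" and A: "\<And>j. j \<in> J \<Longrightarrow> A j \<in> sets F"
    \<comment> \<open>The constraint on the fresh draw, void when the cylinder does not restrict
      coordinate \<open>i\<close>.\<close>
    define B where "B = (if i \<in> J then A i else space F)"
    have B: "B \<in> sets F" using A by (auto simp: B_def)
    have 1: "prod_emb UNIV (\<lambda>_. F) J (Pi\<^sub>E J A) \<in> sets ?P"
      using J A by (intro sets_PiM_I) auto
    have 2: "prod_emb UNIV (\<lambda>_. F) (J - {i}) (Pi\<^sub>E (J - {i}) A) \<in> sets ?P"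
      using J A by (intro sets_PiM_I) auto
    have emb: "t \<in> prod_emb UNIV (\<lambda>_. F) K (Pi\<^sub>E K A)
        \<longleftrightarrow> (\<forall>j. t j \<in> space F) \<and> (\<forall>j\<in>K. t j \<in> A j)" for t :: "'i \<Rightarrow> 'a" and K
      by (auto simp: prod_emb_def PiE_iff)
    have sp: "x \<in> space F" if "j \<in> J" "x \<in> A j" for j x
      using A[OF that(1)] that(2) sets.sets_into_space by blast
    have "?u -` prod_emb UNIV (\<lambda>_. F) J (Pi\<^sub>E J A) \<inter> space (?P \<Otimes>\<^sub>M F)
      = prod_emb UNIV (\<lambda>_. F) (J - {i}) (Pi\<^sub>E (J - {i}) A) \<times> B" (is "?L = ?R")
    proof (rule set_eqI)
      fix z :: "('i \<Rightarrow> 'a) \<times> 'a"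
      obtain t x where z: "z = (t, x)" by (cases z)
      have "z \<in> ?L \<longleftrightarrow> (\<forall>j. t j \<in> space F) \<and> x \<in> space F \<and> (\<forall>j\<in>J. (t(i := x)) j \<in> A j)"
        by (auto simp: z emb space_pair_measure space_PiM PiE_iff)
      also have "\<dots> \<longleftrightarrow> (\<forall>j. t j \<in> space F) \<and> x \<in> B \<and> (\<forall>j\<in>J - {i}. t j \<in> A j)"
        using sp[of i x] by (cases "i \<in> J") (auto simp: B_def)
      also have "\<dots> \<longleftrightarrow> z \<in> ?R"
        by (auto simp: z emb)
      finally show "z \<in> ?L \<longleftrightarrow> z \<in> ?R" .
    qed
    then have "emeasure (distr (?P \<Otimes>\<^sub>M F) ?P ?u) (prod_emb UNIV (\<lambda>_. F) J (Pi\<^sub>E J A))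
      = (\<Prod>j\<in>J - {i}. emeasure F (A j)) * emeasure F B"
      using 1 2 B J A emeasure_PiM_emb[of "J - {i}" A]
      by (simp add: emeasure_distr F.emeasure_pair_measure_Times)
    also have "\<dots> = (\<Prod>j\<in>J. emeasure F (A j))"
      using J by (auto simp: B_def F.emeasure_space_1 prod.remove[of J i] mult.commute)
    finally show "emeasure (distr (?P \<Otimes>\<^sub>M F) ?P ?u) (prod_emb UNIV (\<lambda>_. F) J (Pi\<^sub>E J A))
      = (\<Prod>j\<in>J. emeasure F (A j))" .
  qed simp
qed

lemma nn_integral_PiM_fun_upd:
  assumes F: "prob_space F" and f: "f \<in> borel_measurable (\<Pi>\<^sub>M j\<in>UNIV. F)"
  shows "(\<integral>\<^sup>+t. f t \<partial>(\<Pi>\<^sub>M j\<in>UNIV. F)) = (\<integral>\<^sup>+t. \<integral>\<^sup>+x. f (t(i := x)) \<partial>F \<partial>(\<Pi>\<^sub>M j\<in>UNIV. F))"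
    (is "(\<integral>\<^sup>+t. f t \<partial>?P) = _")
proof -
  interpret F: prob_space F by fact
  have u[measurable]: "(\<lambda>(t, x). t(i := x)) \<in> measurable (?P \<Otimes>\<^sub>M F) ?P"
    by (rule measurable_PiM_single') (auto simp: space_pair_measure space_PiM split_beta')
  note f[measurable]
  have "(\<integral>\<^sup>+t. f t \<partial>?P) = (\<integral>\<^sup>+t. f t \<partial>distr (?P \<Otimes>\<^sub>M F) ?P (\<lambda>(t, x). t(i := x)))"
    by (simp add: distr_PiM_fun_upd[OF F])
  also have "\<dots> = (\<integral>\<^sup>+z. f (case z of (t, x) \<Rightarrow> t(i := x)) \<partial>(?P \<Otimes>\<^sub>M F))"
    by (rule nn_integral_distr) measurable
  also have "\<dots> = (\<integral>\<^sup>+t. \<integral>\<^sup>+x. f (t(i := x)) \<partial>F \<partial>?P)"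
    by (subst F.nn_integral_fst[symmetric]) (auto simp: split_beta')
  finally show ?thesis .
qed

text \<open>Stands in for conditioning on the past: it is applied with \<open>i = Suc n\<close> and
  \<open>j = n\<close>, the pair that drives the step from symbol \<open>n\<close> to the
  next.\<close>

lemma nn_integral_timing_fun_upd:
  assumes FA: "prob_space FA" and FS: "prob_space FS" and f: "f \<in> borel_measurable (timing FA FS)"
  shows "(\<integral>\<^sup>+\<omega>. f \<omega> \<partial>timing FA FS)
    = (\<integral>\<^sup>+(t, s). \<integral>\<^sup>+(x, y). f (t(i := x), s(j := y)) \<partial>(FA \<Otimes>\<^sub>M FS) \<partial>timing FA FS)"
proof -
  interpret A: prob_space FA by fact
  interpret S: prob_space FS by fact
  let ?PA = "\<Pi>\<^sub>M j\<in>UNIV. FA" and ?PS = "\<Pi>\<^sub>M j\<in>UNIV. FS"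
  interpret PA: prob_space ?PA by (intro prob_space_PiM FA)
  interpret PS: prob_space ?PS by (intro prob_space_PiM FS)
  interpret FF: pair_prob_space FA FS by unfold_locales
  interpret AS: pair_sigma_finite FA ?PS by unfold_locales
  have [measurable]: "(\<lambda>(t, x). t(i := x)) \<in> measurable (?PA \<Otimes>\<^sub>M FA) ?PA"
     "(\<lambda>(t, x). t(j := x)) \<in> measurable (?PS \<Otimes>\<^sub>M FS) ?PS"
    by (rule measurable_PiM_single'; auto simp: space_pair_measure space_PiM split_beta')+
  have f'[measurable]: "f \<in> borel_measurable (?PA \<Otimes>\<^sub>M ?PS)" using f by (simp add: timing_def)
  have uA[measurable]: "(\<lambda>z. (g z)(i := h z)) \<in> measurable N ?PA"
    if [measurable]: "g \<in> measurable N ?PA" "h \<in> measurable N FA" for g h N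
    using measurable_compose[of "\<lambda>z. (g z, h z)" N "?PA \<Otimes>\<^sub>M FA" "\<lambda>(t, x). t(i := x)" ?PA] by simp
  have uS[measurable]: "(\<lambda>z. (g z)(j := h z)) \<in> measurable N ?PS"
    if [measurable]: "g \<in> measurable N ?PS" "h \<in> measurable N FS" for g h N
    using measurable_compose[of "\<lambda>z. (g z, h z)" N "?PS \<Otimes>\<^sub>M FS" "\<lambda>(t, x). t(j := x)" ?PS] by simp
  have "(\<integral>\<^sup>+\<omega>. f \<omega> \<partial>timing FA FS) = (\<integral>\<^sup>+t. \<integral>\<^sup>+s. f (t, s) \<partial>?PS \<partial>?PA)"
    by (simp add: timing_def PS.nn_integral_fst)
  also have "\<dots> = (\<integral>\<^sup>+t. \<integral>\<^sup>+x. \<integral>\<^sup>+s. f (t(i := x), s) \<partial>?PS \<partial>FA \<partial>?PA)"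
    by (rule nn_integral_PiM_fun_upd[OF FA]) measurable
  also have "\<dots> = (\<integral>\<^sup>+t. \<integral>\<^sup>+x. \<integral>\<^sup>+s. \<integral>\<^sup>+y. f (t(i := x), s(j := y)) \<partial>FS \<partial>?PS \<partial>FA \<partial>?PA)"
    by (intro nn_integral_cong nn_integral_PiM_fun_upd[OF FS]) (auto simp: space_PiM)
  \<comment> \<open>Tonelli exchanges the fresh interarrival time with the service sequence, so that
    both fresh draws become innermost.\<close>
  also have "\<dots> = (\<integral>\<^sup>+t. \<integral>\<^sup>+s. \<integral>\<^sup>+x. \<integral>\<^sup>+y. f (t(i := x), s(j := y)) \<partial>FS \<partial>FA \<partial>?PS \<partial>?PA)"
    by (intro nn_integral_cong AS.Fubini'[symmetric]) (simp add: space_PiM)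
  also have "\<dots> = (\<integral>\<^sup>+t. \<integral>\<^sup>+s. \<integral>\<^sup>+z. f (t(i := fst z), s(j := snd z)) \<partial>(FA \<Otimes>\<^sub>M FS) \<partial>?PS \<partial>?PA)"
    by (intro nn_integral_cong, subst S.nn_integral_fst[symmetric]) (auto simp: space_PiM)
  also have "\<dots> = (\<integral>\<^sup>+w. \<integral>\<^sup>+z. f ((fst w)(i := fst z), (snd w)(j := snd z)) \<partial>(FA \<Otimes>\<^sub>M FS) \<partial>(?PA \<Otimes>\<^sub>M ?PS))"
  proof (subst PS.nn_integral_fst[symmetric])
    have "(\<lambda>p. f ((fst (fst p))(i := fst (snd p)), (snd (fst p))(j := snd (snd p))))
        \<in> borel_measurable ((?PA \<Otimes>\<^sub>M ?PS) \<Otimes>\<^sub>M (FA \<Otimes>\<^sub>M FS))"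
      by measurable
    then show "(\<lambda>w. \<integral>\<^sup>+z. f ((fst w)(i := fst z), (snd w)(j := snd z)) \<partial>(FA \<Otimes>\<^sub>M FS))
        \<in> borel_measurable (?PA \<Otimes>\<^sub>M ?PS)"
      by (intro FF.borel_measurable_nn_integral) (simp add: split_beta')
  qed simp
  finally show ?thesis by (simp add: timing_def split_beta')
qed

section \<open>Exponential interarrival times and one-step second-moment bounds\<close>

text \<open>Here \<open>v\<close> plays the role of waiting plus service time of the current symbol.
  For \<open>x \<ge> v\<close> the integrand is the constant \<open>\<kappa> - l\<close>; once that
  is subtracted, an integral over \<open>{0..v}\<close> with an explicit antiderivative
  remains.\<close>

lemma has_bochner_integral_exponential_reflected:
  fixes l \<kappa> v :: real
  assumes l: "0 < l" and v: "0 \<le> v"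
  shows "has_bochner_integral (exponential_distribution l)
    (\<lambda>x. (\<kappa> - l) * exp (- \<kappa> * max (v - x) 0) - \<kappa> * l * max (v - x) 0)
    (\<kappa> - l * exp (- \<kappa> * v) - \<kappa> * l * v)"
proof -
  interpret E: prob_space "exponential_distribution l"
    using l by (rule prob_space_exponential_density)
  \<comment> \<open>An antiderivative without division by \<open>\<kappa> - l\<close>, so
    \<open>\<kappa> = l\<close> is no exception. At \<open>x = v\<close> its first and last terms
    cancel and the middle one is 0, so no \<open>exp (- l * v)\<close> is left.\<close>
  define G where "G x = l * exp (- \<kappa> * v) * exp ((\<kappa> - l) * x) + \<kappa> * l * (v - x) * exp (- l * x)
    - l * exp (- l * x)" for x
  define g where "g x = l * exp (- x * l) *
    ((\<kappa> - l) * exp (- \<kappa> * (v - x)) - \<kappa> * l * (v - x) - (\<kappa> - l))" for x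
  have DG: "DERIV G x :> g x" for x
  proof -
    have e: "exp (- \<kappa> * v) * exp ((\<kappa> - l) * x) = exp (- x * l) * exp (- \<kappa> * (v - x))"
      by (simp add: exp_add[symmetric] algebra_simps)
    have "DERIV G x :> l * exp (- \<kappa> * v) * (exp ((\<kappa> - l) * x) * (\<kappa> - l))
       + (\<kappa> * l * (- exp (- l * x) + (v - x) * (exp (- l * x) * (- l)))) - l * (exp (- l * x) * (- l))"
      unfolding G_def by (auto intro!: derivative_eq_intros simp: algebra_simps)
    also have "l * exp (- \<kappa> * v) * (exp ((\<kappa> - l) * x) * (\<kappa> - l)) = l * (\<kappa> - l) * (exp (- x * l) * exp (- \<kappa> * (v - x)))"
      unfolding e[symmetric] by (simp add: mult_ac)
    also have "l * (\<kappa> - l) * (exp (- x * l) * exp (- \<kappa> * (v - x)))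
       + (\<kappa> * l * (- exp (- l * x) + (v - x) * (exp (- l * x) * (- l)))) - l * (exp (- l * x) * (- l)) = g x"
      by (simp add: g_def algebra_simps)
    finally show ?thesis .
  qed
  have "has_bochner_integral lborel (\<lambda>x. indicator {0..v} x *\<^sub>R g x) (G v - G 0)"
  proof (rule has_bochner_integral_FTC_Icc[OF v])
    show "(G has_vector_derivative g x) (at x within {0..v})" for x
      using DG[of x] by (simp add: has_real_derivative_iff_has_vector_derivative has_vector_derivative_at_within)
    show "continuous_on {0..v} g"
      unfolding g_def by (intro continuous_intros)
  qed
  moreover have "G v - G 0 = l - l * exp (- \<kappa> * v) - \<kappa> * l * v"
    by (simp add: G_def exp_add[symmetric] algebra_simps)
  moreover have "indicator {0..v} x *\<^sub>R g x = exponential_density l x *\<^sub>R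
      ((\<kappa> - l) * exp (- \<kappa> * max (v - x) 0) - \<kappa> * l * max (v - x) 0 - (\<kappa> - l))" for x
    using v by (auto simp: g_def exponential_density_def max_def indicator_def)
  ultimately have "has_bochner_integral lborel (\<lambda>x. exponential_density l x *\<^sub>R
      ((\<kappa> - l) * exp (- \<kappa> * max (v - x) 0) - \<kappa> * l * max (v - x) 0 - (\<kappa> - l)))
      (l - l * exp (- \<kappa> * v) - \<kappa> * l * v)"
    by simp
  then have 1: "has_bochner_integral (exponential_distribution l)
      (\<lambda>x. (\<kappa> - l) * exp (- \<kappa> * max (v - x) 0) - \<kappa> * l * max (v - x) 0 - (\<kappa> - l))
      (l - l * exp (- \<kappa> * v) - \<kappa> * l * v)"
    using l by (intro has_bochner_integral_density) (auto simp: exponential_density_nonneg)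
  have 2: "has_bochner_integral (exponential_distribution l) (\<lambda>x. \<kappa> - l) (\<kappa> - l)"
    using E.prob_space by (simp add: has_bochner_integral_iff)
  have "l - l * exp (- \<kappa> * v) - \<kappa> * l * v + (\<kappa> - l) = \<kappa> - l * exp (- \<kappa> * v) - \<kappa> * l * v"
    by simp
  with has_bochner_integral_add[OF 1 2] show ?thesis
    by (simp only: diff_add_cancel)
qed

lemma exponential_distribution_moments:
  assumes l: "0 < l"
  shows "has_bochner_integral (exponential_distribution l) (\<lambda>x. x) (1 / l)"
    and "integrable (exponential_distribution l) (\<lambda>x. x\<^sup>2)"
    and "AE x in exponential_distribution l. 0 \<le> x"
proof -
  interpret E: prob_space "exponential_distribution l"
    using l by (rule prob_space_exponential_density)
  have D: "distributed (exponential_distribution l) lborel (\<lambda>x. x) (exponential_density l)"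
    using l by (auto simp: distributed_def exponential_density_nonneg distr_id2)
  show "has_bochner_integral (exponential_distribution l) (\<lambda>x. x) (1 / l)"
    using E.has_bochner_integral_erlang_ith_moment[OF l D, of 1] by simp
  show "integrable (exponential_distribution l) (\<lambda>x. x\<^sup>2)"
    using E.erlang_ith_moment_integrable[OF l D] by simp
  show "AE x in exponential_distribution l. 0 \<le> x"
    by (subst AE_density) (auto simp: exponential_density_def)
qed

text \<open>Expanding the square, the cross term has the sign of \<open>z * expectation g\<close>
  and drops out. This covers both uses: a reflected walk (\<open>z \<ge> 0\<close>, negative mean
  step) and a martingale (mean step 0, any \<open>z\<close>).\<close>

lemma (in prob_space) nn_integral_square_shift_le:
  fixes g K :: "'a \<Rightarrow> real"
  assumes g: "integrable M g" and K: "integrable M K" and gK: "AE x in M. (g x)\<^sup>2 \<le> K x"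
    and z: "z * expectation g \<le> 0"
  shows "(\<integral>\<^sup>+x. ennreal ((z + g x)\<^sup>2) \<partial>M) \<le> ennreal (z\<^sup>2) + ennreal (expectation K)"
proof -
  have [measurable]: "g \<in> borel_measurable M" using g by simp
  have g2: "integrable M (\<lambda>x. (g x)\<^sup>2)"
    by (rule Bochner_Integration.integrable_bound[OF K]) (use gK in auto)
  have K0: "AE x in M. 0 \<le> K x"
    using gK by eventually_elim (rule order_trans[OF zero_le_power2])
  have "(\<integral>\<^sup>+x. ennreal ((z + g x)\<^sup>2) \<partial>M) = (\<integral>\<^sup>+x. ennreal (z\<^sup>2 + 2 * z * g x + (g x)\<^sup>2) \<partial>M)"
    by (simp add: power2_sum algebra_simps)
  also have "\<dots> = ennreal (expectation (\<lambda>x. z\<^sup>2 + 2 * z * g x + (g x)\<^sup>2))"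
  proof (rule nn_integral_eq_integral)
    show "integrable M (\<lambda>x. z\<^sup>2 + 2 * z * g x + (g x)\<^sup>2)"
      using g g2 by simp
    have "0 \<le> z\<^sup>2 + 2 * z * g x + (g x)\<^sup>2" for x
      using zero_le_power2[of "z + g x"] by (simp add: power2_sum algebra_simps)
    then show "AE x in M. 0 \<le> z\<^sup>2 + 2 * z * g x + (g x)\<^sup>2" by simp
  qed
  also have "expectation (\<lambda>x. z\<^sup>2 + 2 * z * g x + (g x)\<^sup>2)
      = z\<^sup>2 + 2 * (z * expectation g) + expectation (\<lambda>x. (g x)\<^sup>2)"
    using g g2 prob_space by simp
  also have "ennreal \<dots> \<le> ennreal (z\<^sup>2 + expectation K)"
    using z integral_mono_AE[OF g2 K gK] by (intro ennreal_leI) linarith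
  also have "\<dots> = ennreal (z\<^sup>2) + ennreal (expectation K)"
    using K0 by (intro ennreal_plus integral_nonneg_AE) simp_all
  finally show ?thesis .
qed

text \<open>The one-step bound is required after overwriting coordinates \<open>Suc n\<close> and
  \<open>n\<close>, which carry the new randomness of step \<open>n\<close>. Since resampling leaves
  the total integral unchanged, the increments add up.\<close>

lemma nn_integral_timing_growth:
  assumes FA: "prob_space FA" and FS: "prob_space FS"
    and meas: "\<And>n. \<Phi> n \<in> borel_measurable (timing FA FS)"
    and zero: "\<And>\<omega>. \<Phi> 0 \<omega> = 0"
    and step: "\<And>n t s. (\<integral>\<^sup>+(x, y). \<Phi> (Suc n) (t(Suc n := x), s(n := y)) \<partial>(FA \<Otimes>\<^sub>M FS)) \<le> \<Phi> n (t, s) + C"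
  shows "(\<integral>\<^sup>+\<omega>. \<Phi> n \<omega> \<partial>timing FA FS) \<le> of_nat n * C"
proof (induction n)
  case 0
  then show ?case by (simp add: zero)
next
  case (Suc n)
  interpret FA: prob_space FA by fact
  interpret FS: prob_space FS by fact
  interpret PA: prob_space "\<Pi>\<^sub>M j\<in>(UNIV::nat set). FA" by (intro prob_space_PiM FA)
  interpret PS: prob_space "\<Pi>\<^sub>M j\<in>(UNIV::nat set). FS" by (intro prob_space_PiM FS)
  interpret P: pair_prob_space "\<Pi>\<^sub>M j\<in>(UNIV::nat set). FA" "\<Pi>\<^sub>M j\<in>(UNIV::nat set). FS" ..
  have "(\<integral>\<^sup>+\<omega>. \<Phi> (Suc n) \<omega> \<partial>timing FA FS) \<le> (\<integral>\<^sup>+\<omega>. \<Phi> n \<omega> + C \<partial>timing FA FS)"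
    using step
    by (subst nn_integral_timing_fun_upd[OF FA FS meas, of _ "Suc n" n])
       (auto intro!: nn_integral_mono simp: split_beta')
  also have "\<dots> = (\<integral>\<^sup>+\<omega>. \<Phi> n \<omega> \<partial>timing FA FS) + C"
    using meas[of n] P.emeasure_space_1 by (simp add: nn_integral_add timing_def)
  also have "\<dots> \<le> of_nat (Suc n) * C"
    using Suc.IH by (simp add: distrib_right add.commute[of C])
  finally show ?case .
qed

section \<open>The M/GI/1 queue\<close>

text \<open>With unit mean service time \<open>l\<close> is the load of the queue, and
  \<open>l < 1\<close> is its stability condition.\<close>

locale queue =
  fixes l \<kappa> :: real and FS :: "real measure"
  assumes l: "0 < l" "l < 1" and \<kappa>: "0 < \<kappa>" and FS: "real_distribution FS"
    and FS_nonneg: "AE y in FS. 0 \<le> y"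
    and FS_mean: "has_bochner_integral FS (\<lambda>x. x) 1"
begin

abbreviation "FA \<equiv> exponential_distribution l"
abbreviation "P \<equiv> timing FA FS"
abbreviation "N \<equiv> FA \<Otimes>\<^sub>M FS"

sublocale FA: prob_space FA
  using l by (intro prob_space_exponential_density) auto
sublocale FS: real_distribution FS by (rule FS)
sublocale N: pair_prob_space FA FS ..
sublocale PA: prob_space "\<Pi>\<^sub>M j\<in>(UNIV::nat set). FA" by (intro prob_space_PiM FA.prob_space_axioms)
sublocale PS: prob_space "\<Pi>\<^sub>M j\<in>(UNIV::nat set). FS" by (intro prob_space_PiM FS.prob_space_axioms)
sublocale PP: pair_prob_space "\<Pi>\<^sub>M j\<in>(UNIV::nat set). FA" "\<Pi>\<^sub>M j\<in>(UNIV::nat set). FS" ..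
sublocale P: prob_space P
  unfolding timing_def by (rule PP.prob_space_axioms)

lemma integrable_fst_N: "integrable FA f \<Longrightarrow> integrable N (\<lambda>z. f (fst z))" for f :: "real \<Rightarrow> real"
  by (rule integrable_distr[where M' = FA and T = fst, unfolded comp_def]) (simp_all add: FS.distr_pair_fst)

lemma integral_fst_N: "f \<in> borel_measurable FA \<Longrightarrow> (\<integral>z. f (fst z) \<partial>N) = integral\<^sup>L FA f" for f :: "real \<Rightarrow> real"
  by (subst integral_distr[where N = FA, symmetric]) (simp_all add: FS.distr_pair_fst)


section \<open>The potential and its mean after one step\<close>

abbreviation "laplace \<equiv> laplace_transform FS \<kappa>"

text \<open>
  The two summands are balanced so that the term \<open>E exp (- l * (w + S))\<close>, which comes from the atom
  of the waiting time at 0, cancels from the conditional mean of the potential after one step.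
\<close>

definition potential :: "real \<Rightarrow> real" where
  "potential w = (\<kappa> - l) * exp (- \<kappa> * w) - \<kappa> * l * w"

text \<open>The reflected exponential integral at \<open>v = w + S\<close>, averaged over the
  service time \<open>S\<close>: \<open>exp (- \<kappa> * (w + S))\<close> averages to
  \<open>laplace * exp (- \<kappa> * w)\<close>, and \<open>w + S\<close> to
  \<open>w + 1\<close>.\<close>

definition potential_mean :: "real \<Rightarrow> real" where
  "potential_mean w = \<kappa> - l * laplace * exp (- \<kappa> * w) - \<kappa> * l * (w + 1)"

lemma potential_measurable[measurable]: "potential \<in> borel_measurable borel"
  unfolding potential_def by measurable

lemma integrable_snd_N: "integrable FS f \<Longrightarrow> integrable N (\<lambda>z. f (snd z))" for f :: "real \<Rightarrow> real"
proof -
  assume f: "integrable FS f"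
  interpret S: pair_prob_space FS FA ..
  have "integrable (FS \<Otimes>\<^sub>M FA) (\<lambda>z. f (fst z))"
    by (rule integrable_distr[where M' = FS and T = fst, unfolded comp_def])
      (simp_all add: FA.distr_pair_fst f)
  from S.integrable_product_swap[OF this] show "integrable N (\<lambda>z. f (snd z))"
    by (simp add: split_beta')
qed

lemma AE_N_nonneg: "AE z in N. 0 \<le> fst z \<and> 0 \<le> snd z"
proof (rule N.AE_pair_measure)
  show "{z \<in> space N. 0 \<le> fst z \<and> 0 \<le> snd z} \<in> sets N"
    by measurable
  show "AE x in FA. AE y in FS. 0 \<le> fst (x, y) \<and> 0 \<le> snd (x, y)"
    using exponential_distribution_moments(3)[OF l(1)] FS_nonneg by auto
qed

lemma FS_integrable: "integrable FS (\<lambda>y. y)" and FS_integral: "(\<integral>y. y \<partial>FS) = 1"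
  using FS_mean by (auto simp: has_bochner_integral_iff)

lemma FA_integrable: "integrable FA (\<lambda>x. x)" and FA_integral: "(\<integral>x. x \<partial>FA) = 1 / l"
  using exponential_distribution_moments(1)[OF l(1)] by (auto simp: has_bochner_integral_iff)

lemma exp_le_1: "0 \<le> w \<Longrightarrow> exp (- \<kappa> * w) \<le> 1"
  using \<kappa> by simp

lemma integrable_exp_FS: "integrable FS (\<lambda>y. exp (- \<kappa> * y))"
  by (rule FS.integrable_const_bound[where B = 1]) (use FS_nonneg \<kappa> in auto)

lemma integral_potential_step:
  assumes w: "0 \<le> w"
  shows "has_bochner_integral N (\<lambda>z. potential (max (w + snd z - fst z) 0)) (potential_mean w)"
proof -
  have int: "integrable N (\<lambda>z. potential (max (w + snd z - fst z) 0))"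
  proof (rule Bochner_Integration.integrable_bound)
    show "integrable N (\<lambda>z. \<bar>\<kappa> - l\<bar> + \<kappa> * l * (w + snd z + fst z))"
      using integrable_fst_N[OF FA_integrable] integrable_snd_N[OF FS_integrable] by simp
    show "AE z in N. norm (potential (max (w + snd z - fst z) 0)) \<le> norm (\<bar>\<kappa> - l\<bar> + \<kappa> * l * (w + snd z + fst z))"
      using AE_N_nonneg
    proof eventually_elim
      case (elim z)
      let ?v = "max (w + snd z - fst z) 0"
      have "\<bar>potential ?v\<bar> \<le> \<bar>(\<kappa> - l) * exp (- \<kappa> * ?v)\<bar> + \<bar>\<kappa> * l * ?v\<bar>"
        unfolding potential_def by (rule abs_triangle_ineq4)
      also have "\<bar>(\<kappa> - l) * exp (- \<kappa> * ?v)\<bar> \<le> \<bar>\<kappa> - l\<bar>"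
        using exp_le_1[of ?v] by (simp add: abs_mult mult_left_le)
      also have "\<bar>\<kappa> * l * ?v\<bar> \<le> \<kappa> * l * (w + snd z + fst z)"
        using elim \<kappa> l w by (simp add: abs_mult)
      finally show ?case by simp
    qed
  qed measurable
  \<comment> \<open>With the service time \<open>y\<close> fixed, only the exponential interarrival
    time is random; the service time is averaged afterwards.\<close>
  have inner: "(\<integral>x. potential (max (w + y - x) 0) \<partial>FA) = \<kappa> - l * exp (- \<kappa> * w) * exp (- \<kappa> * y) - \<kappa> * l * (w + y)"
    if "0 \<le> y" for y
    using has_bochner_integral_exponential_reflected[OF l(1), of "w + y" \<kappa>] w that
    by (simp add: potential_def has_bochner_integral_iff mult.assoc exp_add[symmetric] distrib_left)
  have "(\<integral>z. potential (max (w + snd z - fst z) 0) \<partial>N) = (\<integral>y. \<integral>x. potential (max (w + y - x) 0) \<partial>FA \<partial>FS)"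
    using N.integral_snd[of "\<lambda>x y. potential (max (w + y - x) 0)"] int by (simp add: split_beta')
  also have "\<dots> = (\<integral>y. \<kappa> - l * exp (- \<kappa> * w) * exp (- \<kappa> * y) - \<kappa> * l * (w + y) \<partial>FS)"
    using FS_nonneg by (intro integral_cong_AE) (auto simp: inner)
  also have "\<dots> = potential_mean w"
    using integrable_exp_FS FS_integrable FS_integral FS.prob_space
    by (simp add: potential_mean_def laplace_transform_def distrib_left)
  finally show ?thesis
    using int by (simp add: has_bochner_integral_iff)
qed

end

section \<open>The waiting-time recursion: measurability, dependence on the past, truncation\<close>

lemma arrival_measurable:
  assumes FA: "sets FA = sets borel"
  shows "(\<lambda>\<omega>. arrival (fst \<omega>) j) \<in> borel_measurable (timing FA FS)"
proof -
  have "(\<lambda>\<omega>. fst \<omega> i) \<in> borel_measurable (timing FA FS)" for i :: nat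
    unfolding timing_def measurable_cong_sets[OF refl FA, symmetric] by measurable
  then show ?thesis
    unfolding arrival_def by (intro borel_measurable_sum) auto
qed

lemma waiting_nonneg: "0 \<le> waiting t s j"
  by (cases j) (simp_all add: waiting_0 waiting_Suc)

lemma waiting_step: "waiting t s (Suc j) = max (waiting t s j + s j - t (Suc j)) 0"
  by (simp add: waiting_Suc arrival_def)

lemma waiting_measurable:
  assumes FA: "sets FA = sets borel" and FS: "sets FS = sets borel"
  shows "(\<lambda>\<omega>. waiting (fst \<omega>) (snd \<omega>) j) \<in> borel_measurable (timing FA FS)"
proof (induction j)
  case 0
  then show ?case by (simp add: waiting_0)
next
  case (Suc j)
  have "(\<lambda>\<omega>. fst \<omega> i) \<in> borel_measurable (timing FA FS)" for i :: nat
    unfolding timing_def measurable_cong_sets[OF refl FA, symmetric] by measurable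
  moreover have "(\<lambda>\<omega>. snd \<omega> i) \<in> borel_measurable (timing FA FS)" for i :: nat
    unfolding timing_def measurable_cong_sets[OF refl FS, symmetric] by measurable
  ultimately show ?case
    using Suc.IH unfolding waiting_step by measurable
qed

lemma waiting_cong:
  "(\<And>i. i \<le> j \<Longrightarrow> t i = t' i) \<Longrightarrow> (\<And>i. i < j \<Longrightarrow> s i = s' i) \<Longrightarrow> waiting t s j = waiting t' s' j"
  by (induction j) (simp_all add: waiting_0 waiting_step)

text \<open>Adaptedness: waiting times up to symbol \<open>n\<close> do not see the coordinates that
  are resampled for the next step.\<close>

lemma waiting_fun_upd[simp]: "j \<le> n \<Longrightarrow> waiting (t(Suc n := x)) (s(n := y)) j = waiting t s j"
  by (rule waiting_cong) auto

text \<open>Reflection at 0 is monotone and 1-Lipschitz, so each cut-off part of a service time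
  raises all later waiting times by at most its own size.\<close>

lemma waiting_le_truncated:
  "waiting t s j \<le> waiting t (\<lambda>i. min (s i) B) j + (\<Sum>i<j. max (s i - B) 0)"
proof (induction j)
  case 0
  then show ?case by (simp add: waiting_0)
next
  case (Suc j)
  let ?S = "\<Sum>i<j. max (s i - B) 0"
  have "0 \<le> ?S" by (intro sum_nonneg) auto
  moreover have "s j = min (s j) B + max (s j - B) 0" by auto
  ultimately show ?case
    using Suc.IH unfolding waiting_step sum.lessThan_Suc by linarith
qed

section \<open>Marginals of the timing law, truncation, and sublinear mean waiting time\<close>

context queue
begin

lemma component_measurable[measurable]:
  "(\<lambda>\<omega>. fst \<omega> i) \<in> borel_measurable P" "(\<lambda>\<omega>. snd \<omega> i) \<in> borel_measurable P"
proof -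
  have FA: "sets FA = sets borel" by simp
  show "(\<lambda>\<omega>. fst \<omega> i) \<in> borel_measurable P"
    unfolding timing_def measurable_cong_sets[OF refl FA, symmetric] by measurable
  have FS: "sets FS = sets borel" by simp
  show "(\<lambda>\<omega>. snd \<omega> i) \<in> borel_measurable P"
    unfolding timing_def measurable_cong_sets[OF refl FS, symmetric] by measurable
qed

lemma component_measurable':
  "(\<lambda>\<omega>. fst \<omega> i) \<in> measurable P FA" "(\<lambda>\<omega>. snd \<omega> i) \<in> measurable P FS"
  using component_measurable[of i] FS.events_eq_borel
  by (simp_all add: measurable_def sets_eq_imp_space_eq[OF FS.events_eq_borel])

lemma waiting_measurable_P[measurable]: "(\<lambda>\<omega>. waiting (fst \<omega>) (snd \<omega>) j) \<in> borel_measurable P"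
  by (rule waiting_measurable) simp_all

lemma distr_interarrival: "distr P FA (\<lambda>\<omega>. fst \<omega> i) = FA"
proof -
  have "distr P FA (\<lambda>\<omega>. fst \<omega> i) = distr (distr P (\<Pi>\<^sub>M j\<in>UNIV. FA) fst) FA (\<lambda>t. t i)"
    by (subst distr_distr) (auto simp: comp_def timing_def)
  also have "distr P (\<Pi>\<^sub>M j\<in>UNIV. FA) fst = (\<Pi>\<^sub>M j\<in>UNIV. FA)"
    unfolding timing_def by (rule PS.distr_pair_fst)
  finally show ?thesis
    using distr_PiM_component[of UNIV "\<lambda>_. FA" i] FA.prob_space_axioms by simp
qed

lemma distr_service: "distr P FS (\<lambda>\<omega>. snd \<omega> i) = FS"
proof (rule measure_eqI)
  fix X assume "X \<in> sets (distr P FS (\<lambda>\<omega>. snd \<omega> i))"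
  then have [measurable]: "X \<in> sets FS" "X \<in> sets borel" by auto
  let ?Z = "(\<lambda>s. s i) -` X \<inter> space (\<Pi>\<^sub>M j\<in>UNIV. FS)"
  have Z: "?Z \<in> sets (\<Pi>\<^sub>M j\<in>(UNIV::nat set). FS)" 
    by (rule measurable_sets[of _ _ FS]) simp_all
  have "emeasure (distr P FS (\<lambda>\<omega>. snd \<omega> i)) X = emeasure P ((\<lambda>\<omega>. snd \<omega> i) -` X \<inter> space P)"
    by (rule emeasure_distr) (simp_all add: component_measurable')
  also have "(\<lambda>\<omega>. snd \<omega> i) -` X \<inter> space P = space (\<Pi>\<^sub>M j\<in>(UNIV::nat set). FA) \<times> ?Z"
    by (auto simp: timing_def space_pair_measure)
  also have "emeasure P \<dots> = emeasure (\<Pi>\<^sub>M j\<in>(UNIV::nat set). FS) ?Z"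
    using Z unfolding timing_def by (subst PS.emeasure_pair_measure_Times) (auto simp: PA.emeasure_space_1)
  also have "\<dots> = emeasure (distr (\<Pi>\<^sub>M j\<in>(UNIV::nat set). FS) FS (\<lambda>s. s i)) X"
    by (rule emeasure_distr[symmetric]) simp_all
  also have "\<dots> = emeasure FS X"
    using distr_PiM_component[of UNIV "\<lambda>_. FS" i] FS.prob_space_axioms by simp
  finally show "emeasure (distr P FS (\<lambda>\<omega>. snd \<omega> i)) X = emeasure FS X" .
qed simp

lemma interarrival_integral:
  fixes f :: "real \<Rightarrow> real"
  assumes "integrable FA f"
  shows "integrable P (\<lambda>\<omega>. f (fst \<omega> i))" "(\<integral>\<omega>. f (fst \<omega> i) \<partial>P) = (\<integral>x. f x \<partial>FA)"
proof -
  note m = component_measurable'(1)[of i]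
  show "integrable P (\<lambda>\<omega>. f (fst \<omega> i))"
    by (rule integrable_distr[OF m]) (simp add: distr_interarrival assms)
  show "(\<integral>\<omega>. f (fst \<omega> i) \<partial>P) = (\<integral>x. f x \<partial>FA)"
    using assms by (subst integral_distr[OF m, symmetric]) (auto simp: distr_interarrival)
qed

lemma service_integral:
  fixes f :: "real \<Rightarrow> real"
  assumes "integrable FS f"
  shows "integrable P (\<lambda>\<omega>. f (snd \<omega> i))" "(\<integral>\<omega>. f (snd \<omega> i) \<partial>P) = (\<integral>y. f y \<partial>FS)"
proof -
  note m = component_measurable'(2)[of i]
  show "integrable P (\<lambda>\<omega>. f (snd \<omega> i))"
    by (rule integrable_distr[OF m]) (simp add: distr_service assms)
  show "(\<integral>\<omega>. f (snd \<omega> i) \<partial>P) = (\<integral>y. f y \<partial>FS)"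
    using assms by (subst integral_distr[OF m, symmetric]) (auto simp: distr_service)
qed

definition excess :: "real \<Rightarrow> real" where
  "excess B = (\<integral>y. max (y - B) 0 \<partial>FS)"

lemma integrable_excess: "integrable FS (\<lambda>y. max (y - B) 0)"
  using FS_integrable by (intro Bochner_Integration.integrable_max) auto

lemma excess_bounds: "0 \<le> B \<Longrightarrow> 0 \<le> excess B" "0 \<le> B \<Longrightarrow> excess B \<le> 1"
proof -
  show "0 \<le> excess B" unfolding excess_def by simp
  assume "0 \<le> B"
  then show "excess B \<le> 1"
    unfolding excess_def FS_integral[symmetric]
    using FS_nonneg by (intro integral_mono_AE integrable_excess FS_integrable) auto
qed

text \<open>Dominated convergence against \<open>\<bar>y\<bar>\<close>: a first moment suffices.
  Every truncation level used below is chosen here.\<close>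

lemma excess_small:
  assumes "0 < \<theta>"
  obtains B where "0 \<le> B" "excess B < \<theta>"
proof -
  have "(\<lambda>k. \<integral>y. max (y - real k) 0 \<partial>FS) \<longlonglongrightarrow> (\<integral>y. 0 \<partial>FS)"
  proof (rule integral_dominated_convergence[where w = "\<lambda>y. \<bar>y\<bar>"])
    show "integrable FS abs" using FS_integrable by (rule integrable_abs)
    show "AE y in FS. (\<lambda>k. max (y - real k) 0) \<longlonglongrightarrow> 0"
    proof (rule AE_I2)
      fix y :: real
      have "\<forall>\<^sub>F k in sequentially. max (y - real k) 0 = 0"
        using eventually_ge_at_top[of "nat \<lceil>y\<rceil>"] by eventually_elim linarith
      then show "(\<lambda>k. max (y - real k) 0) \<longlonglongrightarrow> 0"
        by (rule tendsto_eventually)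
    qed
  qed auto
  then have "\<forall>\<^sub>F k in sequentially. excess (real k) < \<theta>"
    using assms unfolding excess_def by (intro order_tendstoD(2)) auto
  then obtain k where "excess (real k) < \<theta>"
    by (auto simp: eventually_sequentially)
  then show ?thesis by (intro that[of "real k"]) auto
qed


lemma nn_integral_P_growth:
  assumes "\<And>n. \<Phi> n \<in> borel_measurable P" and "\<And>\<omega>. \<Phi> 0 \<omega> = 0"
    and "\<And>n t s. (\<integral>\<^sup>+z. \<Phi> (Suc n) (t(Suc n := fst z), s(n := snd z)) \<partial>N) \<le> \<Phi> n (t, s) + C"
  shows "(\<integral>\<^sup>+\<omega>. \<Phi> n \<omega> \<partial>P) \<le> of_nat n * C"
  using assms by (intro nn_integral_timing_growth[OF FA.prob_space_axioms FS.prob_space_axioms])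
    (simp_all add: split_beta')

lemma N_integrable_square_bound: "integrable N (\<lambda>z. (D + E * fst z)\<^sup>2)"
proof -
  have "integrable FA (\<lambda>x. D\<^sup>2 + (2 * D * E) * x + E\<^sup>2 * x\<^sup>2)"
    using FA_integrable exponential_distribution_moments(2)[OF l(1)] by simp
  then have "integrable FA (\<lambda>x. (D + E * x)\<^sup>2)"
    by (simp add: power2_sum power_mult_distrib algebra_simps)
  then show ?thesis by (rule integrable_fst_N)
qed

text \<open>Passes from second moments of order \<open>n\<close> to first moments of order
  \<open>o(n)\<close>, through \<open>\<bar>x\<bar> \<le> x\<^sup>2 / a + a\<close>. The shape
  \<open>n * \<theta> + const\<close> is kept because such bounds add and rescale easily.\<close>

lemma second_moment_bound:
  assumes f: "\<And>n. f n \<in> borel_measurable P" and bound: "\<And>n. (\<integral>\<^sup>+\<omega>. ennreal ((f n \<omega>)\<^sup>2) \<partial>P) \<le> of_nat n * ennreal C"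
    and C: "0 \<le> C" and \<theta>: "0 < \<theta>"
  shows "integrable P (f n)" "(\<integral>\<omega>. \<bar>f n \<omega>\<bar> \<partial>P) \<le> real n * \<theta> + (C / \<theta> + \<theta>)"
proof -
  have [measurable]: "f n \<in> borel_measurable P" by (rule f)
  have b: "(\<integral>\<^sup>+\<omega>. ennreal ((f n \<omega>)\<^sup>2) \<partial>P) \<le> ennreal (real n * C)"
    using bound[of n] C by (simp add: ennreal_mult ennreal_of_nat_eq_real_of_nat)
  have sq: "integrable P (\<lambda>\<omega>. (f n \<omega>)\<^sup>2)"
    using b by (intro integrableI_bounded) (auto simp: le_less_trans)
  show int: "integrable P (f n)"
    by (rule P.square_integrable_imp_integrable[OF _ sq]) simp
  have sqb: "(\<integral>\<omega>. (f n \<omega>)\<^sup>2 \<partial>P) \<le> real n * C"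
    using b C by (subst integral_eq_nn_integral) (auto intro: enn2real_leI)
  \<comment> \<open>Of order \<open>n\<close>, so that the quadratic term stays bounded by
    \<open>C / \<theta>\<close>; \<open>Suc n\<close> keeps it positive at
    \<open>n = 0\<close>.\<close>
  define a where "a = real (Suc n) * \<theta>"
  have a: "0 < a" using \<theta> by (simp add: a_def)
  have "\<bar>x\<bar> \<le> x\<^sup>2 / a + a" for x :: real
  proof (cases "\<bar>x\<bar> \<le> a")
    case False
    then have "\<bar>x\<bar> * a \<le> \<bar>x\<bar> * \<bar>x\<bar>" by (intro mult_left_mono) auto
    then have "\<bar>x\<bar> \<le> x\<^sup>2 / a" using a by (simp add: field_simps power2_eq_square)
    then show ?thesis using a by simp
  qed (use a in \<open>simp add: add_increasing\<close>)
  then have "(\<integral>\<omega>. \<bar>f n \<omega>\<bar> \<partial>P) \<le> (\<integral>\<omega>. (f n \<omega>)\<^sup>2 / a + a \<partial>P)"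
    using int sq by (intro integral_mono) auto
  also have "\<dots> \<le> real n * C / a + a"
    using sq sqb a P.prob_space by (simp add: divide_right_mono)
  also have "real n * C / a \<le> real (Suc n) * C / a"
    using C a by (intro divide_right_mono mult_right_mono) auto
  also have "\<dots> = C / \<theta>"
    by (simp add: a_def)
  also have "a = real n * \<theta> + \<theta>" by (simp add: a_def algebra_simps)
  finally show "(\<integral>\<omega>. \<bar>f n \<omega>\<bar> \<partial>P) \<le> real n * \<theta> + (C / \<theta> + \<theta>)" by simp
qed

text \<open>Reflection does not increase the square, as
  \<open>(max v 0)\<^sup>2 \<le> v\<^sup>2\<close>, and the walk sits at a nonnegative point when a
  step of mean at most \<open>1 - 1 / l < 0\<close> is added. So each step costs at most the mean of
  \<open>(B + x)\<^sup>2\<close>, where \<open>x\<close> is the interarrival time.\<close>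

lemma truncated_waiting_second_moment:
  assumes B: "0 \<le> B"
  obtains C where "0 \<le> C"
    and "\<And>n. (\<integral>\<^sup>+\<omega>. ennreal ((waiting (fst \<omega>) (\<lambda>i. min (snd \<omega> i) B) n)\<^sup>2) \<partial>P) \<le> of_nat n * ennreal C"
proof
  let ?U = "\<lambda>\<omega>. waiting (fst \<omega>) (\<lambda>i. min (snd \<omega> i) B)"
  let ?K = "\<lambda>z. (B + 1 * fst z)\<^sup>2"
  let ?C = "\<integral>z. ?K z \<partial>N"
  let ?g = "\<lambda>z. min (snd z) B - fst z"
  show "0 \<le> ?C" by simp
  have U[measurable]: "(\<lambda>\<omega>. ?U \<omega> n) \<in> borel_measurable P" for n
    by (induction n) (simp_all add: waiting_0 waiting_step)
  have intmin: "integrable FS (\<lambda>y. min y B)"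
    using FS_integrable by (intro Bochner_Integration.integrable_min) auto
  have gint: "integrable N ?g"
    using integrable_fst_N[OF FA_integrable] integrable_snd_N[OF intmin] by simp
  have "integral\<^sup>L N ?g = (\<integral>z. min (snd z) B \<partial>N) - (\<integral>z. fst z \<partial>N)"
    using integrable_fst_N[OF FA_integrable] integrable_snd_N[OF intmin] by simp
  also have "(\<integral>z. fst z \<partial>N) = 1 / l"
    using integral_fst_N[of "\<lambda>x. x"] FA_integral by simp
  also have "(\<integral>z. min (snd z) B \<partial>N) = (\<integral>y. min y B \<partial>FS)"
    using N.integral_snd[of "\<lambda>x y. min y B"] integrable_snd_N[OF intmin] FA.prob_space
    by (simp add: split_beta')
  also have "\<dots> \<le> (\<integral>y. y \<partial>FS)"
    by (intro integral_mono intmin FS_integrable) auto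
  also have "\<dots> - 1 / l \<le> 0"
    using l by (simp add: FS_integral)
  finally have gneg: "integral\<^sup>L N ?g \<le> 0" by simp
  have gK: "AE z in N. (?g z)\<^sup>2 \<le> ?K z"
    using AE_N_nonneg
  proof eventually_elim
    case (elim z)
    then have "\<bar>?g z\<bar> \<le> \<bar>B + 1 * fst z\<bar>" using B by auto
    then show ?case by (simp only: abs_le_square_iff)
  qed
  show "(\<integral>\<^sup>+\<omega>. ennreal ((?U \<omega> n)\<^sup>2) \<partial>P) \<le> of_nat n * ennreal ?C" for n
  proof (rule nn_integral_P_growth)
    fix n t s
    define u where "u = ?U (t, s) n"
    have "?U (t(Suc n := x), s(n := y)) n = u" for x y
      unfolding u_def by (rule waiting_cong) auto
    then have "(\<integral>\<^sup>+z. ennreal ((?U (t(Suc n := fst z), s(n := snd z)) (Suc n))\<^sup>2) \<partial>N)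
        = (\<integral>\<^sup>+z. ennreal ((max (u + ?g z) 0)\<^sup>2) \<partial>N)"
      by (simp add: waiting_step add_diff_eq)
    also have "\<dots> \<le> (\<integral>\<^sup>+z. ennreal ((u + ?g z)\<^sup>2) \<partial>N)"
      by (intro nn_integral_mono ennreal_leI) (auto simp: max_def)
    also have "\<dots> \<le> ennreal (u\<^sup>2) + ennreal ?C"
      using gneg waiting_nonneg[of t "\<lambda>i. min (s i) B" n]
      by (intro N.nn_integral_square_shift_le gint N_integrable_square_bound gK)
         (simp add: u_def mult_nonneg_nonpos)
    finally show "(\<integral>\<^sup>+z. ennreal ((?U (t(Suc n := fst z), s(n := snd z)) (Suc n))\<^sup>2) \<partial>N)
        \<le> ennreal ((?U (t, s) n)\<^sup>2) + ennreal ?C"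
      by (simp add: u_def)
  qed (simp_all add: waiting_0)
qed

lemma excess_sum:
  "integrable P (\<lambda>\<omega>. \<Sum>i<n. max (snd \<omega> i - B) 0)"
  "(\<integral>\<omega>. (\<Sum>i<n. max (snd \<omega> i - B) 0) \<partial>P) = real n * excess B"
  using service_integral[OF integrable_excess[of B]] by (simp_all add: excess_def)

text \<open>Half of \<open>\<theta>\<close> pays for the cut-off service times, whose sum has mean
  \<open>n * excess B\<close>, the other half for the truncated queue. \<open>C\<close> depends on
  \<open>\<theta>\<close> but not on \<open>n\<close>.\<close>

lemma waiting_sublinear:
  assumes \<theta>: "0 < \<theta>"
  obtains C where "0 \<le> C" "\<And>n. integrable P (\<lambda>\<omega>. waiting (fst \<omega>) (snd \<omega>) n)"
    "\<And>n. (\<integral>\<omega>. waiting (fst \<omega>) (snd \<omega>) n \<partial>P) \<le> real n * \<theta> + C"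
proof -
  obtain B where B: "0 \<le> B" "excess B < \<theta> / 2"
    using excess_small[of "\<theta> / 2"] \<theta> by auto
  let ?U = "\<lambda>n \<omega>. waiting (fst \<omega>) (\<lambda>i. min (snd \<omega> i) B) n"
  let ?W = "\<lambda>n \<omega>. waiting (fst \<omega>) (snd \<omega>) n"
  let ?S = "\<lambda>n \<omega>. \<Sum>i<n. max (snd \<omega> i - B) 0"
  obtain C where C: "0 \<le> C" "\<And>n. (\<integral>\<^sup>+\<omega>. ennreal ((?U n \<omega>)\<^sup>2) \<partial>P) \<le> of_nat n * ennreal C"
    using truncated_waiting_second_moment[OF B(1)] by blast
  have U: "?U n \<in> borel_measurable P" for n
    by (induction n) (simp_all add: waiting_0 waiting_step)
  note U2 = second_moment_bound[OF U C(2,1) half_gt_zero[OF \<theta>]]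
  have W: "integrable P (?W n)" for n
  proof (rule Bochner_Integration.integrable_bound)
    show "integrable P (\<lambda>\<omega>. ?U n \<omega> + ?S n \<omega>)"
      using U2(1) excess_sum(1) by (rule Bochner_Integration.integrable_add)
    show "AE \<omega> in P. norm (?W n \<omega>) \<le> norm (?U n \<omega> + ?S n \<omega>)"
    proof (rule AE_I2)
      fix \<omega>
      show "norm (?W n \<omega>) \<le> norm (?U n \<omega> + ?S n \<omega>)"
        using waiting_le_truncated[of "fst \<omega>" "snd \<omega>" n B] waiting_nonneg[of "fst \<omega>" "snd \<omega>" n]
        by simp
    qed
  qed simp
  have "(\<integral>\<omega>. ?W n \<omega> \<partial>P) \<le> real n * \<theta> + (C / (\<theta> / 2) + \<theta> / 2)" for n
  proof -
    have "(\<integral>\<omega>. ?W n \<omega> \<partial>P) \<le> (\<integral>\<omega>. ?U n \<omega> + ?S n \<omega> \<partial>P)"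
      using U2(1) excess_sum(1) W
      by (intro integral_mono Bochner_Integration.integrable_add waiting_le_truncated) auto
    also have "\<dots> = (\<integral>\<omega>. \<bar>?U n \<omega>\<bar> \<partial>P) + real n * excess B"
      using U2(1) excess_sum by (simp add: Bochner_Integration.integral_add waiting_nonneg)
    also have "\<dots> \<le> (real n * (\<theta> / 2) + (C / (\<theta> / 2) + \<theta> / 2)) + real n * (\<theta> / 2)"
      using U2(2)[of n] B by (intro add_mono mult_left_mono) auto
    finally show ?thesis by (simp add: algebra_simps)
  qed
  with W C(1) \<theta> show ?thesis by (intro that[of "C / (\<theta> / 2) + \<theta> / 2"]) auto
qed


section \<open>A law of large numbers for the survival probabilities\<close>

text \<open>Equals \<open>\<kappa> * (1 - l * \<alpha>)\<close> for the \<open>\<alpha>\<close> of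
  the theorem.\<close>

definition drift :: real where "drift = \<kappa> - l * (1 - laplace)"

text \<open>The Pollaczek-Khinchine transform of the stationary M/GI/1 waiting time at
  \<open>\<kappa>\<close>, that is, the stationary mean of \<open>exp (- \<kappa> * W)\<close>; it
  is the \<open>q\<close> of the overview.\<close>

definition survival :: real where "survival = \<kappa> * (1 - l) / drift"

lemma laplace_bounds: "0 \<le> laplace" "laplace \<le> 1" "1 - laplace \<le> \<kappa>"
proof -
  show "0 \<le> laplace" unfolding laplace_transform_def by simp
  have "laplace \<le> (\<integral>y. 1 \<partial>FS)"
    unfolding laplace_transform_def
    using FS_nonneg \<kappa> by (intro integral_mono_AE integrable_exp_FS) auto
  then show "laplace \<le> 1" using FS.prob_space by simp
  have "(\<integral>y. 1 - \<kappa> * y \<partial>FS) \<le> laplace"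
    unfolding laplace_transform_def
  proof (intro integral_mono integrable_exp_FS)
    show "1 - \<kappa> * y \<le> exp (- \<kappa> * y)" for y using exp_ge_add_one_self[of "- \<kappa> * y"] by simp
  qed (use FS_integrable in simp)
  then show "1 - laplace \<le> \<kappa>"
    using FS_integrable FS_integral FS.prob_space by simp
qed

lemma drift_pos: "0 < drift"
proof -
  have "l * (1 - laplace) \<le> l * \<kappa>" using laplace_bounds(3) l by (intro mult_left_mono) auto
  also have "\<dots> < 1 * \<kappa>" using l \<kappa> by (intro mult_strict_right_mono)
  finally show ?thesis by (simp add: drift_def)
qed

lemma survival_pos: "0 < survival"
  using drift_pos \<kappa> l by (simp add: survival_def)

text \<open>The Poisson equation of the waiting-time chain for the function
  \<open>exp (- \<kappa> * w)\<close>, up to the factor \<open>drift\<close>: the terms linear in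
  \<open>w\<close> cancel, and the remaining constant is \<open>- drift * survival\<close>.\<close>

lemma potential_minus_mean: "potential w - potential_mean w = drift * (exp (- \<kappa> * w) - survival)"
proof -
  have "drift * survival = \<kappa> * (1 - l)"
    using drift_pos by (simp add: survival_def)
  then show ?thesis
    unfolding right_diff_distrib by (simp add: potential_def potential_mean_def drift_def algebra_simps)
qed

lemma survival_average_telescope:
  "drift * (\<Sum>j<n. exp (- \<kappa> * waiting t s j) - survival)
    = (\<Sum>j<n. potential (waiting t s (Suc j)) - potential_mean (waiting t s j)) + potential 0 - potential (waiting t s n)"
proof -
  have "drift * (\<Sum>j<n. exp (- \<kappa> * waiting t s j) - survival)
      = (\<Sum>j<n. potential (waiting t s j) - potential_mean (waiting t s j))"
    by (simp only: sum_distrib_left potential_minus_mean)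
  also have "\<dots> = (\<Sum>j<n. potential (waiting t s (Suc j)) - potential_mean (waiting t s j))
      - (\<Sum>j<n. potential (waiting t s (Suc j)) - potential (waiting t s j))"
    by (simp add: sum_subtractf)
  finally have "drift * (\<Sum>j<n. exp (- \<kappa> * waiting t s j) - survival) = \<dots>" .
  then show ?thesis
    using sum_lessThan_telescope[of "\<lambda>j. potential (waiting t s j)" n] by (simp add: waiting_0)
qed

text \<open>
  The martingale increment of the potential, compensated for the part of the service time above \<open>B\<close>:
  this gives it a second moment although the service time need only have a first one.
\<close>

definition noise :: "real \<Rightarrow> real \<Rightarrow> real \<times> real \<Rightarrow> real" where
  "noise B w z = potential (max (w + snd z - fst z) 0) - potential_mean w + \<kappa> * l * (max (snd z - B) 0 - excess B)"

lemma noise_measurable[measurable]: "case_prod (noise B) \<in> borel_measurable (borel \<Otimes>\<^sub>M (borel \<Otimes>\<^sub>M borel))"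
  unfolding noise_def potential_mean_def by measurable

lemma noise_integral:
  assumes w: "0 \<le> w"
  shows "has_bochner_integral N (noise B w) 0"
proof -
  have "(\<integral>z. max (snd z - B) 0 \<partial>N) = excess B"
    using N.integral_snd[of "\<lambda>x y. max (y - B) 0"] integrable_snd_N[OF integrable_excess] FA.prob_space
    by (simp add: split_beta' excess_def)
  then have "has_bochner_integral N (\<lambda>z. max (snd z - B) 0) (excess B)"
    using integrable_snd_N[OF integrable_excess] by (simp add: has_bochner_integral_iff)
  then show ?thesis
    using integral_potential_step[OF w] N.prob_space unfolding noise_def has_bochner_integral_iff
    by simp
qed

text \<open>The compensator removes the unbounded part of the service time, so the bound involves
  neither the service time nor \<open>w\<close>, only the interarrival time, which is square
  integrable.\<close>

lemma noise_bound:
  assumes B: "0 \<le> B" and w: "0 \<le> w" and z: "0 \<le> fst z" "0 \<le> snd z"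
  shows "\<bar>noise B w z\<bar> \<le> (\<bar>\<kappa> - l\<bar> + \<kappa> + l + 2 * \<kappa> * l + \<kappa> * l * B) + \<kappa> * l * fst z"
proof -
  obtain x y where xy: "z = (x, y)" by (cases z)
  define w' where "w' = max (w + y - x) 0"
  define e where "e = max (y - B) 0"
  have w': "0 \<le> w'" by (simp add: w'_def)
  have 1: "\<bar>(\<kappa> - l) * exp (- \<kappa> * w')\<bar> \<le> \<bar>\<kappa> - l\<bar>"
    using exp_le_1[OF w'] by (simp add: abs_mult mult_left_le)
  have "laplace * exp (- \<kappa> * w) \<le> 1"
    using exp_le_1[OF w] laplace_bounds by (intro mult_le_one) auto
  then have 2: "\<bar>l * laplace * exp (- \<kappa> * w)\<bar> \<le> l"
    using l laplace_bounds by (simp add: abs_mult mult.assoc)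
  \<comment> \<open>Here \<open>y - e = min y B\<close> lies between 0 and \<open>B\<close>, and
    reflection can only shorten a downward move.\<close>
  have "\<bar>w' - w - e\<bar> \<le> B + x"
    using z w B by (auto simp: w'_def e_def xy max_def abs_if)
  then have 3: "\<bar>\<kappa> * l * (w' - w - e)\<bar> \<le> \<kappa> * l * B + \<kappa> * l * x"
    using \<kappa> l by (simp add: abs_mult mult.assoc distrib_left[symmetric])
  have 4: "\<bar>\<kappa> * l * excess B\<bar> \<le> \<kappa> * l"
    using excess_bounds[OF B] \<kappa> l by (simp add: abs_mult mult_left_le)
  have "noise B w z = (\<kappa> - l) * exp (- \<kappa> * w') - \<kappa> + l * laplace * exp (- \<kappa> * w) + \<kappa> * l
      - \<kappa> * l * (w' - w - e) - \<kappa> * l * excess B"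
    by (simp add: noise_def potential_def potential_mean_def w'_def e_def xy algebra_simps)
  then show ?thesis
    using 1 2 3 4 \<kappa> l mult_pos_pos[OF \<kappa> l(1)] unfolding xy fst_conv by linarith
qed

text \<open>Resampling for step \<open>n\<close> changes only the last summand, whose mean given the
  past is 0. The cross term therefore vanishes, and each step adds at most the second moment of the
  bound in \<open>noise_bound\<close>.\<close>

lemma noise_sum_second_moment:
  assumes B: "0 \<le> B"
  obtains C where "0 \<le> C"
    and "\<And>n. (\<integral>\<^sup>+\<omega>. ennreal ((\<Sum>j<n. noise B (waiting (fst \<omega>) (snd \<omega>) j) (fst \<omega> (Suc j), snd \<omega> j))\<^sup>2) \<partial>P)
        \<le> of_nat n * ennreal C"
proof
  define D where "D = \<bar>\<kappa> - l\<bar> + \<kappa> + l + 2 * \<kappa> * l + \<kappa> * l * B"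
  let ?K = "\<lambda>z. (D + (\<kappa> * l) * fst z)\<^sup>2"
  let ?C = "\<integral>z. ?K z \<partial>N"
  let ?Q = "\<lambda>n \<omega>. \<Sum>j<n. noise B (waiting (fst \<omega>) (snd \<omega>) j) (fst \<omega> (Suc j), snd \<omega> j)"
  show "0 \<le> ?C" by simp
  show "(\<integral>\<^sup>+\<omega>. ennreal ((?Q n \<omega>)\<^sup>2) \<partial>P) \<le> of_nat n * ennreal ?C" for n
  proof (rule nn_integral_P_growth)
    fix n t s
    define w where "w = waiting t s n"
    have w: "0 \<le> w" by (simp add: w_def waiting_nonneg)
    have "?Q (Suc n) (t(Suc n := x), s(n := y)) = ?Q n (t, s) + noise B w (x, y)" for x y
      by (simp add: w_def)
    then have "(\<integral>\<^sup>+z. ennreal ((?Q (Suc n) (t(Suc n := fst z), s(n := snd z)))\<^sup>2) \<partial>N)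
        = (\<integral>\<^sup>+z. ennreal ((?Q n (t, s) + noise B w z)\<^sup>2) \<partial>N)"
      by (simp add: w_def)
    also have "\<dots> \<le> ennreal ((?Q n (t, s))\<^sup>2) + ennreal ?C"
    proof (rule N.nn_integral_square_shift_le)
      show "AE z in N. (noise B w z)\<^sup>2 \<le> ?K z"
        using AE_N_nonneg
      proof eventually_elim
        case (elim z)
        then have "\<bar>noise B w z\<bar> \<le> \<bar>D + \<kappa> * l * fst z\<bar>"
          using noise_bound[OF B w] unfolding D_def by (meson abs_ge_self order_trans)
        then show ?case by (simp only: abs_le_square_iff)
      qed
    qed (use noise_integral[OF w] N_integrable_square_bound in \<open>auto simp: has_bochner_integral_iff\<close>)
    finally show "(\<integral>\<^sup>+z. ennreal ((?Q (Suc n) (t(Suc n := fst z), s(n := snd z)))\<^sup>2) \<partial>N)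
        \<le> ennreal ((?Q n (t, s))\<^sup>2) + ennreal ?C" .
  qed simp_all
qed

text \<open>Everything left over by the telescoping is of order \<open>o(n)\<close> in mean: the
  martingale, the truncation compensators and the final potential, whose linear part is controlled
  by \<open>waiting_sublinear\<close>.\<close>

lemma survival_average:
  assumes \<theta>: "0 < \<theta>"
  obtains C where "0 \<le> C"
    "\<And>n. integrable P (\<lambda>\<omega>. \<bar>(\<Sum>j<n. exp (- \<kappa> * waiting (fst \<omega>) (snd \<omega>) j)) - n * survival\<bar>)"
    "\<And>n. (\<integral>\<omega>. \<bar>(\<Sum>j<n. exp (- \<kappa> * waiting (fst \<omega>) (snd \<omega>) j)) - n * survival\<bar> \<partial>P) \<le> real n * \<theta> + C"
proof -
  let ?W = "\<lambda>n \<omega>. waiting (fst \<omega>) (snd \<omega>) n"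
  let ?Z = "\<lambda>n \<omega>. (\<Sum>j<n. exp (- \<kappa> * ?W j \<omega>)) - real n * survival"
  \<comment> \<open>The error budget: the martingale costs \<open>n * \<eta>\<close>, and the excess
    sum, its mean and the final waiting time cost \<open>\<kappa> * l * n * \<eta>\<close> each; the
    total is divided by \<open>drift\<close>.\<close>
  define \<eta> where "\<eta> = \<theta> * drift / (1 + 3 * \<kappa> * l)"
  have pos: "0 < \<kappa> * l" using \<kappa> l by simp
  then have \<eta>: "0 < \<eta>" using \<theta> drift_pos \<kappa> by (simp add: \<eta>_def)
  obtain B where B: "0 \<le> B" "excess B < \<eta>"
    using excess_small[OF \<eta>] by auto
  let ?Q = "\<lambda>n \<omega>. \<Sum>j<n. noise B (?W j \<omega>) (fst \<omega> (Suc j), snd \<omega> j)"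
  let ?S = "\<lambda>n \<omega>. \<Sum>i<n. max (snd \<omega> i - B) 0"
  obtain C1 where C1: "0 \<le> C1" "\<And>n. (\<integral>\<^sup>+\<omega>. ennreal ((?Q n \<omega>)\<^sup>2) \<partial>P) \<le> of_nat n * ennreal C1"
    using noise_sum_second_moment[OF B(1)] by blast
  have Q: "?Q n \<in> borel_measurable P" for n by measurable
  note Q2 = second_moment_bound[OF Q C1(2,1) \<eta>]
  obtain C2 where C2: "0 \<le> C2" "\<And>n. integrable P (?W n)"
    "\<And>n. (\<integral>\<omega>. ?W n \<omega> \<partial>P) \<le> real n * \<eta> + C2"
    using waiting_sublinear[OF \<eta>] by blast
  define R where "R n \<omega> = \<bar>?Q n \<omega>\<bar> + \<kappa> * l * ?S n \<omega> + \<kappa> * l * real n * excess B + \<bar>\<kappa> - l\<bar> + \<kappa> * l * ?W n \<omega>" for n \<omega>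
  have ZR: "drift * \<bar>?Z n \<omega>\<bar> \<le> R n \<omega>" for n \<omega>
  proof -
    have "drift * ?Z n \<omega> = (\<Sum>j<n. potential (?W (Suc j) \<omega>) - potential_mean (?W j \<omega>)) + potential 0 - potential (?W n \<omega>)"
      using survival_average_telescope[of "fst \<omega>" "snd \<omega>" n] by (simp add: sum_subtractf)
    also have "(\<Sum>j<n. potential (?W (Suc j) \<omega>) - potential_mean (?W j \<omega>)) = ?Q n \<omega> - \<kappa> * l * (?S n \<omega> - real n * excess B)"
      unfolding noise_def by (simp add: waiting_step sum.distrib sum_subtractf sum_distrib_left right_diff_distrib)
    finally have eq: "drift * ?Z n \<omega> = ?Q n \<omega> - \<kappa> * l * ?S n \<omega> + \<kappa> * l * real n * excess B
        + (\<kappa> - l) * (1 - exp (- \<kappa> * ?W n \<omega>)) + \<kappa> * l * ?W n \<omega>"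
      by (simp add: potential_def algebra_simps)
    have "\<bar>(\<kappa> - l) * (1 - exp (- \<kappa> * ?W n \<omega>))\<bar> \<le> \<bar>\<kappa> - l\<bar>"
      using exp_le_1[OF waiting_nonneg] by (simp add: abs_mult mult_left_le)
    moreover have "0 \<le> \<kappa> * l * ?S n \<omega>"
      using \<kappa> l by (intro mult_nonneg_nonneg sum_nonneg) auto
    moreover have "0 \<le> \<kappa> * l * real n * excess B"
      using \<kappa> l excess_bounds(1)[OF B(1)] by (intro mult_nonneg_nonneg) auto
    moreover have "0 \<le> \<kappa> * l * ?W n \<omega>"
      using \<kappa> l waiting_nonneg by (intro mult_nonneg_nonneg) auto
    ultimately have "\<bar>drift * ?Z n \<omega>\<bar> \<le> R n \<omega>"
      unfolding eq R_def by linarith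
    then show ?thesis using drift_pos by (simp add: abs_mult)
  qed
  have Rint: "integrable P (R n)" for n
    unfolding R_def using Q2(1)[where n = n] excess_sum(1)[where n = n and B = B] C2(2)[of n] by simp
  have Zint: "integrable P (\<lambda>\<omega>. \<bar>?Z n \<omega>\<bar>)" for n
  proof (rule Bochner_Integration.integrable_bound)
    show "integrable P (\<lambda>\<omega>. R n \<omega> / drift)" using Rint by simp
    show "AE \<omega> in P. norm \<bar>?Z n \<omega>\<bar> \<le> norm (R n \<omega> / drift)"
    proof (rule AE_I2)
      fix \<omega>
      have "\<bar>?Z n \<omega>\<bar> \<le> R n \<omega> / drift"
        using ZR[of \<omega> n] drift_pos by (simp add: field_simps)
      then show "norm \<bar>?Z n \<omega>\<bar> \<le> norm (R n \<omega> / drift)"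
        by (simp only: real_norm_def abs_idempotent)
    qed
  qed simp
  define C where "C = (C1 / \<eta> + \<eta> + \<bar>\<kappa> - l\<bar> + \<kappa> * l * C2) / drift"
  have "(\<integral>\<omega>. \<bar>?Z n \<omega>\<bar> \<partial>P) \<le> real n * \<theta> + C" for n
  proof -
    have "drift * (\<integral>\<omega>. \<bar>?Z n \<omega>\<bar> \<partial>P) = (\<integral>\<omega>. drift * \<bar>?Z n \<omega>\<bar> \<partial>P)"
      by simp
    also have "\<dots> \<le> (\<integral>\<omega>. R n \<omega> \<partial>P)"
      using Zint Rint ZR by (intro integral_mono) auto
    also have "\<dots> = (\<integral>\<omega>. \<bar>?Q n \<omega>\<bar> \<partial>P) + \<kappa> * l * (real n * excess B) + \<kappa> * l * real n * excess B
        + \<bar>\<kappa> - l\<bar> + \<kappa> * l * (\<integral>\<omega>. ?W n \<omega> \<partial>P)"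
      unfolding R_def using Q2(1)[where n = n] excess_sum[where n = n and B = B] C2(2)[of n] P.prob_space by simp
    also have "\<dots> \<le> (real n * \<eta> + (C1 / \<eta> + \<eta>)) + \<kappa> * l * (real n * \<eta>) + \<kappa> * l * real n * \<eta>
        + \<bar>\<kappa> - l\<bar> + \<kappa> * l * (real n * \<eta> + C2)"
      using Q2(2)[where n = n] B pos C2(3)[of n] by (intro add_mono mult_left_mono) auto
    also have "\<dots> = real n * (\<eta> * (1 + 3 * \<kappa> * l)) + C * drift"
    proof -
      have "C * drift = C1 / \<eta> + \<eta> + \<bar>\<kappa> - l\<bar> + \<kappa> * l * C2"
        using drift_pos by (simp add: C_def)
      then show ?thesis by (simp add: algebra_simps)
    qed
    also have "\<eta> * (1 + 3 * \<kappa> * l) = \<theta> * drift"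
      using pos by (simp add: \<eta>_def)
    finally have "drift * (\<integral>\<omega>. \<bar>?Z n \<omega>\<bar> \<partial>P) \<le> drift * (real n * \<theta> + C)"
      by (simp add: algebra_simps)
    then show ?thesis using drift_pos by simp
  qed
  moreover have "0 \<le> C"
    using C1 C2 \<eta> pos drift_pos by (simp add: C_def)
  ultimately show ?thesis using Zint by (intro that[of C]) auto
qed

end

section \<open>The erasure channel\<close>

lemma measure_bind_pmf:
  "measure_pmf.prob (bind_pmf p f) A = measure_pmf.expectation p (\<lambda>x. measure_pmf.prob (f x) A)"
proof -
  have "measure_pmf.prob (bind_pmf p f) A = enn2real (\<integral>\<^sup>+x. ennreal (measure_pmf.prob (f x) A) \<partial>p)"
    by (simp add: measure_def) (simp add: measure_pmf.emeasure_eq_measure)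
  also have "\<dots> = measure_pmf.expectation p (\<lambda>x. measure_pmf.prob (f x) A)"
    by (rule integral_eq_nn_integral[symmetric]) auto
  finally show ?thesis .
qed

definition mask :: "(nat \<Rightarrow> bool) \<Rightarrow> (nat \<Rightarrow> 'x) \<Rightarrow> nat \<Rightarrow> 'x option" where
  "mask e x j = (if e j then None else Some (x j))"

text \<open>The default \<open>True\<close> counts positions from \<open>n\<close> on as erased, in
  agreement with the \<open>None\<close> padding of output words.\<close>

definition erasures :: "(real \<Rightarrow> real) \<Rightarrow> nat \<Rightarrow> (nat \<Rightarrow> real) \<Rightarrow> (nat \<Rightarrow> bool) pmf" where
  "erasures p n w = Pi_pmf {..<n} True (\<lambda>j. bernoulli_pmf (p (w j)))"

definition patterns :: "nat \<Rightarrow> (nat \<Rightarrow> bool) set" where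
  "patterns n = PiE_dflt {..<n} True (\<lambda>_. UNIV)"

definition survivors :: "nat \<Rightarrow> (nat \<Rightarrow> bool) \<Rightarrow> nat set" where
  "survivors n e = {j. j < n \<and> \<not> e j}"

lemma finite_patterns: "finite (patterns n)"
  unfolding patterns_def by (rule finite_PiE_dflt) auto

lemma survivors_subset: "survivors n e \<subseteq> {..<n}" and finite_survivors: "finite (survivors n e)"
  by (auto simp: survivors_def)

lemma pattern_outside: "e \<in> patterns n \<Longrightarrow> n \<le> j \<Longrightarrow> e j"
  unfolding patterns_def PiE_dflt_def by (simp add: not_less)

lemma set_pmf_erasures: "set_pmf (erasures p n w) \<subseteq> patterns n"
  unfolding erasures_def patterns_def PiE_dflt_def by (subst set_Pi_pmf) (auto simp: PiE_dflt_def)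

lemma finite_set_pmf_erasures: "finite (set_pmf (erasures p n w))"
  by (rule finite_subset[OF set_pmf_erasures finite_patterns])

text \<open>The law of the erasure pattern does not involve the input word, so the pattern can be
  drawn first and the word masked afterwards.\<close>

lemma channel_pmf_eq_mask: "channel_pmf p n w x = map_pmf (\<lambda>e. mask e x) (erasures p n w)"
proof -
  have "channel_pmf p n w x = Pi_pmf {..<n} None
      (\<lambda>j. bernoulli_pmf (p (w j)) \<bind> (\<lambda>b. return_pmf (if b then None else Some (x j))))"
    by (simp add: channel_pmf_def map_pmf_def)
  also have "\<dots> = erasures p n w \<bind> (\<lambda>e. return_pmf (\<lambda>j. if j \<in> {..<n} then if e j then None else Some (x j) else None))"
    unfolding erasures_def by (subst Pi_pmf_bind[where d' = True]) auto
  also have "\<dots> = erasures p n w \<bind> (\<lambda>e. return_pmf (mask e x))"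
  proof (rule bind_pmf_cong[OF refl])
    fix e assume "e \<in> set_pmf (erasures p n w)"
    then have "e \<in> patterns n" using set_pmf_erasures by blast
    then show "return_pmf (\<lambda>j. if j \<in> {..<n} then if e j then None else Some (x j) else None) = return_pmf (mask e x)"
      using pattern_outside[of e n] by (auto simp: mask_def fun_eq_iff not_less)
  qed
  finally show ?thesis by (simp add: map_pmf_def)
qed

lemma pmf_erasures:
  assumes "e \<in> patterns n" "\<And>j. 0 \<le> p (w j)" "\<And>j. p (w j) \<le> 1"
  shows "pmf (erasures p n w) e = (\<Prod>j<n. if e j then p (w j) else 1 - p (w j))"
  using pattern_outside[OF assms(1)] assms(2,3)
  unfolding erasures_def by (subst pmf_Pi') (auto intro!: prod.cong simp: not_less)

lemma expectation_erasures:
  "measure_pmf.expectation (erasures p n w) f = (\<Sum>e\<in>patterns n. pmf (erasures p n w) e * f e)" for f :: "_ \<Rightarrow> real"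
  using set_pmf_erasures[of p n w] by (subst integral_measure_pmf[OF finite_patterns[of n]]) auto

text \<open>Message and pattern are independent and may be drawn in either order. With the pattern
  outermost, the error becomes a counting problem over messages.\<close>

lemma conditional_error_eq:
  assumes M: "finite M" "M \<noteq> {}"
  shows "measure_pmf.prob (bind_pmf (pmf_of_set M) (\<lambda>m. map_pmf (\<lambda>y. (m, g y)) (channel_pmf p n w (f m))))
      {(m, m'). m' \<noteq> m}
    = (\<Sum>e\<in>patterns n. pmf (erasures p n w) e * (card {m\<in>M. g (mask e (f m)) \<noteq> m} / card M))"
proof -
  have frac: "measure_pmf.prob (map_pmf (\<lambda>m. (m, g (mask e (f m)))) (pmf_of_set M)) {(m, m'). m' \<noteq> m}
      = card {m\<in>M. g (mask e (f m)) \<noteq> m} / card M" for e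
    using M by (simp add: measure_pmf_of_set vimage_def Int_def)
  have "bind_pmf (pmf_of_set M) (\<lambda>m. map_pmf (\<lambda>y. (m, g y)) (channel_pmf p n w (f m)))
    = bind_pmf (pmf_of_set M) (\<lambda>m. bind_pmf (erasures p n w) (\<lambda>e. return_pmf (m, g (mask e (f m)))))"
    by (simp add: channel_pmf_eq_mask pmf.map_comp o_def map_pmf_def[symmetric])
  also have "\<dots> = bind_pmf (erasures p n w) (\<lambda>e. map_pmf (\<lambda>m. (m, g (mask e (f m)))) (pmf_of_set M))"
    unfolding map_pmf_def by (rule bind_commute_pmf)
  finally have "measure_pmf.prob (bind_pmf (pmf_of_set M) (\<lambda>m. map_pmf (\<lambda>y. (m, g y)) (channel_pmf p n w (f m))))
      {(m, m'). m' \<noteq> m} = measure_pmf.expectation (erasures p n w) 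
        (\<lambda>e. measure_pmf.prob (map_pmf (\<lambda>m. (m, g (mask e (f m)))) (pmf_of_set M)) {(m, m'). m' \<noteq> m})"
    by (simp only: measure_bind_pmf)
  then show ?thesis by (simp only: frac expectation_erasures)
qed

text \<open>Messages whose codewords agree on the survivors give the same output and hence the same
  decision, so at most one of them is right: right messages inject into words on the
  survivors.\<close>

lemma correct_count_le:
  assumes X: "finite X" and f: "\<forall>m\<in>M. \<forall>j<n. f m j \<in> X" and e: "e \<in> patterns n"
  shows "card {m\<in>M. g (mask e (f m)) = m} \<le> card X ^ card (survivors n e)"
proof -
  let ?C = "{m\<in>M. g (mask e (f m)) = m}"
  have "inj_on (\<lambda>m. restrict (f m) (survivors n e)) ?C"
  proof (rule inj_onI)
    fix m m' assume m: "m \<in> ?C" "m' \<in> ?C"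
      and eq: "restrict (f m) (survivors n e) = restrict (f m') (survivors n e)"
    have "mask e (f m) = mask e (f m')"
    proof
      fix j
      show "mask e (f m) j = mask e (f m') j"
        using fun_cong[OF eq, of j] pattern_outside[OF e, of j]
        by (cases "j < n") (auto simp: mask_def survivors_def split: if_splits)
    qed
    then show "m = m'" using m by (metis (mono_tags, lifting) mem_Collect_eq)
  qed
  moreover have "(\<lambda>m. restrict (f m) (survivors n e)) ` ?C \<subseteq> PiE (survivors n e) (\<lambda>_. X)"
  proof -
    have "f m j \<in> X" if "m \<in> M" "j \<in> survivors n e" for m j
      using f that by (simp add: survivors_def)
    then show ?thesis by (auto simp: restrict_PiE_iff)
  qed
  ultimately have "card ?C \<le> card (PiE (survivors n e) (\<lambda>_. X))"
    using X by (intro card_inj_on_le finite_PiE finite_survivors) auto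
  then show ?thesis by (simp add: card_PiE finite_survivors)
qed

lemma survivors_mean:
  assumes p: "\<And>j. 0 \<le> p (w j)" "\<And>j. p (w j) \<le> 1"
  shows "measure_pmf.expectation (erasures p n w) (\<lambda>e. real (card (survivors n e))) = (\<Sum>j<n. 1 - p (w j))"
proof -
  have "real (card (survivors n e)) = (\<Sum>j<n. of_bool (\<not> e j))" for e
    by (simp add: survivors_def of_bool_def sum.If_cases Int_def)
  then have "measure_pmf.expectation (erasures p n w) (\<lambda>e. real (card (survivors n e)))
      = measure_pmf.expectation (erasures p n w) (\<lambda>e. \<Sum>j<n. of_bool (\<not> e j))"
    by (simp only:)
  also have "\<dots> = (\<Sum>j<n. measure_pmf.expectation (erasures p n w) (\<lambda>e. of_bool (\<not> e j)))"
    by (intro Bochner_Integration.integral_sum integrable_measure_pmf_finite finite_set_pmf_erasures)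
  also have "\<dots> = (\<Sum>j<n. measure_pmf.expectation (map_pmf (\<lambda>e. e j) (erasures p n w)) (\<lambda>b. of_bool (\<not> b)))"
    by simp
  also have "\<dots> = (\<Sum>j<n. 1 - p (w j))"
    unfolding erasures_def by (intro sum.cong refl) (subst Pi_pmf_component, auto simp: p)
  finally show ?thesis .
qed

text \<open>An independent centred Bernoulli variable adds exactly its variance
  \<open>r * (1 - r)\<close>, estimated here by 1.\<close>

lemma nn_integral_bernoulli_sum_square:
  assumes r: "\<And>j. 0 \<le> r j" "\<And>j. r j \<le> (1::real)" and "finite A"
  shows "(\<integral>\<^sup>+e. ennreal ((\<Sum>j\<in>A. of_bool (\<not> e j) - (1 - r j))\<^sup>2) \<partial>Pi_pmf A True (\<lambda>j. bernoulli_pmf (r j)))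
    \<le> of_nat (card A)"
  using \<open>finite A\<close>
proof (induction A)
  case (insert i A)
  let ?P = "Pi_pmf A True (\<lambda>j. bernoulli_pmf (r j))"
  let ?Z = "\<lambda>e. \<Sum>j\<in>A. of_bool (\<not> e j) - (1 - r j)"
  have Z: "(\<Sum>j\<in>insert i A. of_bool (\<not> (e(i := b)) j) - (1 - r j)) = of_bool (\<not> b) - (1 - r i) + ?Z e" for e b
    using insert.hyps by (simp add: sum.insert) (intro sum.cong, auto)
  have "(\<integral>\<^sup>+e. ennreal ((\<Sum>j\<in>insert i A. of_bool (\<not> e j) - (1 - r j))\<^sup>2) \<partial>Pi_pmf (insert i A) True (\<lambda>j. bernoulli_pmf (r j)))
    = (\<integral>\<^sup>+e. \<integral>\<^sup>+b. ennreal ((of_bool (\<not> b) - (1 - r i) + ?Z e)\<^sup>2) \<partial>bernoulli_pmf (r i) \<partial>?P)"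
    using insert.hyps
    by (subst Pi_pmf_insert, simp, simp, subst pair_commute_pmf)
      (simp only: nn_integral_map_pmf nn_integral_pair_pmf' split_beta' fst_conv snd_conv Z)
  also have "\<dots> \<le> (\<integral>\<^sup>+e. ennreal ((?Z e)\<^sup>2) + 1 \<partial>?P)"
  proof (rule nn_integral_mono)
    fix e
    have "(\<integral>\<^sup>+b. ennreal ((of_bool (\<not> b) - (1 - r i) + ?Z e)\<^sup>2) \<partial>bernoulli_pmf (r i))
        = ennreal ((- (1 - r i) + ?Z e)\<^sup>2 * r i + (r i + ?Z e)\<^sup>2 * (1 - r i))"
      using r[of i] by (simp add: ennreal_mult)
    also have "(- (1 - r i) + ?Z e)\<^sup>2 * r i + (r i + ?Z e)\<^sup>2 * (1 - r i) = (?Z e)\<^sup>2 + r i * (1 - r i)"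
      by (simp add: power2_eq_square algebra_simps)
    also have "\<dots> \<le> (?Z e)\<^sup>2 + 1"
      using r[of i] by (intro add_left_mono mult_le_one) auto
    finally show "(\<integral>\<^sup>+b. ennreal ((of_bool (\<not> b) - (1 - r i) + ?Z e)\<^sup>2) \<partial>bernoulli_pmf (r i)) \<le> ennreal ((?Z e)\<^sup>2) + 1"
      by (simp add: ennreal_leI flip: ennreal_1 ennreal_plus)
  qed
  also have "\<dots> \<le> of_nat (card A) + 1"
    using insert.IH by (simp add: nn_integral_add)
  finally show ?case using insert.hyps by (simp add: add.commute)
qed simp

lemma survivors_variance:
  assumes p: "\<And>j. 0 \<le> p (w j)" "\<And>j. p (w j) \<le> 1"
  shows "measure_pmf.expectation (erasures p n w) (\<lambda>e. (real (card (survivors n e)) - (\<Sum>j<n. 1 - p (w j)))\<^sup>2) \<le> n"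
proof -
  have "real (card (survivors n e)) = (\<Sum>j<n. of_bool (\<not> e j))" for e
    by (simp add: survivors_def of_bool_def sum.If_cases Int_def)
  then have "(\<integral>\<^sup>+e. ennreal ((real (card (survivors n e)) - (\<Sum>j<n. 1 - p (w j)))\<^sup>2) \<partial>erasures p n w) \<le> ennreal n"
    using nn_integral_bernoulli_sum_square[of "\<lambda>j. p (w j)" "{..<n}"] p
    by (simp add: erasures_def sum_subtractf ennreal_of_nat_eq_real_of_nat)
  then show ?thesis
    by (subst integral_eq_nn_integral) (auto intro: enn2real_leI)
qed

section \<open>The greedy codebook and its decoder\<close>

lemma card_words_agreeing:
  assumes X: "finite X" and J: "J \<subseteq> {..<n}" and x: "\<forall>j\<in>J. x j \<in> X"
  shows "card {c \<in> PiE {..<n} (\<lambda>_. X). \<forall>j\<in>J. c j = x j} * card X ^ card J = card X ^ n"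
proof -
  have fJ: "finite J" using J finite_subset by auto
  have "{c \<in> PiE {..<n} (\<lambda>_. X). \<forall>j\<in>J. c j = x j} = PiE {..<n} (\<lambda>j. if j \<in> J then {x j} else X)"
  proof (rule set_eqI)
    fix c
    have "c \<in> PiE {..<n} (\<lambda>j. if j \<in> J then {x j} else X)
      \<longleftrightarrow> c \<in> extensional {..<n} \<and> (\<forall>j<n. if j \<in> J then c j = x j else c j \<in> X)"
      by (auto simp: PiE_iff)
    also have "\<dots> \<longleftrightarrow> c \<in> {c \<in> PiE {..<n} (\<lambda>_. X). \<forall>j\<in>J. c j = x j}"
      using J x by (auto simp: PiE_iff subset_iff)
    finally show "c \<in> {c \<in> PiE {..<n} (\<lambda>_. X). \<forall>j\<in>J. c j = x j}
      \<longleftrightarrow> c \<in> PiE {..<n} (\<lambda>j. if j \<in> J then {x j} else X)" by blast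
  qed
  then have "card {c \<in> PiE {..<n} (\<lambda>_. X). \<forall>j\<in>J. c j = x j} = (\<Prod>j<n. if j \<in> J then 1 else card X)"
    by (simp add: card_PiE if_distrib cong: if_cong)
  also have "\<dots> = card X ^ card ({..<n} - J)"
    by (simp add: prod.If_cases Diff_eq)
  also have "card ({..<n} - J) = n - card J"
    using J fJ by (simp add: card_Diff_subset)
  finally show ?thesis
    using card_mono[OF _ J] by (simp add: power_add[symmetric])
qed

lemma exists_le_average:
  fixes g :: "'a \<Rightarrow> real" and b :: real
  assumes "finite W" "W \<noteq> {}" and "(\<Sum>c\<in>W. g c) \<le> card W * b"
  shows "\<exists>c\<in>W. g c \<le> b"
proof (rule ccontr)
  assume "\<not> ?thesis"
  then have "(\<Sum>c\<in>W. b) < (\<Sum>c\<in>W. g c)"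
    using assms by (intro sum_strict_mono) (auto simp: not_le)
  with assms show False by simp
qed

text \<open>Codewords are chosen one at a time, each no worse than the average over all words.\<close>

lemma exists_code:
  fixes \<omega> :: "'e \<Rightarrow> real" and J :: "'e \<Rightarrow> nat set"
  assumes X: "finite X" "X \<noteq> {}" and E: "finite E" and \<omega>: "\<And>e. e \<in> E \<Longrightarrow> 0 \<le> \<omega> e"
    and J: "\<And>e. e \<in> E \<Longrightarrow> J e \<subseteq> {..<n}"
  shows "\<exists>f :: nat \<Rightarrow> nat \<Rightarrow> 'x. (\<forall>m<N. \<forall>j<n. f m j \<in> X) \<and>
    (\<Sum>m<N. \<Sum>m'<m. \<Sum>e\<in>E. \<omega> e * of_bool (\<forall>j\<in>J e. f m j = f m' j))
      \<le> real N * real N * (\<Sum>e\<in>E. \<omega> e / real (card X) ^ card (J e))"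
proof (induction N)
  case 0
  then show ?case by simp
next
  case (Suc N)
  let ?b = "\<Sum>e\<in>E. \<omega> e / real (card X) ^ card (J e)"
  have b: "0 \<le> ?b" using \<omega> by (intro sum_nonneg) auto
  from Suc obtain f where f: "\<forall>m<N. \<forall>j<n. f m j \<in> X"
    and cost: "(\<Sum>m<N. \<Sum>m'<m. \<Sum>e\<in>E. \<omega> e * of_bool (\<forall>j\<in>J e. f m j = f m' j)) \<le> real N * real N * ?b"
    by blast
  let ?W = "PiE {..<n} (\<lambda>_. X)"
  have W: "finite ?W" "?W \<noteq> {}" using X by (auto intro!: finite_PiE simp: PiE_eq_empty_iff)
  have cW: "card ?W = card X ^ n" by (simp add: card_PiE)
  have Xpos: "0 < real (card X)" using X by (simp add: card_gt_0_iff)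
  \<comment> \<open>A uniformly random word agrees with a fixed codeword on \<open>J e\<close> with
    probability \<open>|X|^(-|J e|)\<close>; this is the union bound of random coding.\<close>
  have avg: "(\<Sum>c\<in>?W. of_bool (\<forall>j\<in>J e. c j = f m' j)) = real (card ?W) / real (card X) ^ card (J e)"
    if "e \<in> E" "m' < N" for e m'
  proof -
    have "\<forall>j\<in>J e. f m' j \<in> X" using J f that by blast
    from card_words_agreeing[OF X(1) J[OF that(1)] this]
    have "real (card {c \<in> ?W. \<forall>j\<in>J e. c j = f m' j} * card X ^ card (J e)) = real (card ?W)"
      by (simp only: cW)
    then have "real (card {c \<in> ?W. \<forall>j\<in>J e. c j = f m' j}) * real (card X) ^ card (J e) = real (card ?W)"
      by (simp only: of_nat_mult of_nat_power)
    moreover have "(\<Sum>c\<in>?W. of_bool (\<forall>j\<in>J e. c j = f m' j)) = real (card {c \<in> ?W. \<forall>j\<in>J e. c j = f m' j})"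
      using W by (simp add: of_bool_def sum.If_cases Int_def)
    ultimately show ?thesis using Xpos by (simp only: nonzero_eq_divide_eq[OF less_imp_neq[OF zero_less_power, symmetric]])
  qed
  have "(\<Sum>c\<in>?W. \<Sum>m'<N. \<Sum>e\<in>E. \<omega> e * of_bool (\<forall>j\<in>J e. c j = f m' j))
      = (\<Sum>m'<N. \<Sum>c\<in>?W. \<Sum>e\<in>E. \<omega> e * of_bool (\<forall>j\<in>J e. c j = f m' j))"
    by (rule sum.swap)
  also have "\<dots> = (\<Sum>m'<N. \<Sum>e\<in>E. \<Sum>c\<in>?W. \<omega> e * of_bool (\<forall>j\<in>J e. c j = f m' j))"
    by (intro sum.cong refl sum.swap)
  also have "\<dots> = (\<Sum>m'<N. \<Sum>e\<in>E. \<omega> e * (\<Sum>c\<in>?W. of_bool (\<forall>j\<in>J e. c j = f m' j)))"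
    by (simp only: sum_distrib_left)
  also have "\<dots> = (\<Sum>m'<N. \<Sum>e\<in>E. \<omega> e * (real (card ?W) / real (card X) ^ card (J e)))"
    by (intro sum.cong refl) (simp add: avg)
  also have "\<dots> = card ?W * (real N * ?b)"
    by (simp add: sum_distrib_left mult_ac)
  finally obtain c where c: "c \<in> ?W"
    and new: "(\<Sum>m'<N. \<Sum>e\<in>E. \<omega> e * of_bool (\<forall>j\<in>J e. c j = f m' j)) \<le> real N * ?b"
    using exists_le_average[OF W, where g = "\<lambda>c. \<Sum>m'<N. \<Sum>e\<in>E. \<omega> e * of_bool (\<forall>j\<in>J e. c j = f m' j)"
      and b = "real N * ?b"] by auto
  let ?f = "f(N := c)"
  have "(\<Sum>m<Suc N. \<Sum>m'<m. \<Sum>e\<in>E. \<omega> e * of_bool (\<forall>j\<in>J e. ?f m j = ?f m' j))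
    = (\<Sum>m<N. \<Sum>m'<m. \<Sum>e\<in>E. \<omega> e * of_bool (\<forall>j\<in>J e. f m j = f m' j))
      + (\<Sum>m'<N. \<Sum>e\<in>E. \<omega> e * of_bool (\<forall>j\<in>J e. c j = f m' j))"
    by simp
  also have "\<dots> \<le> real N * real N * ?b + real N * ?b"
    using cost new by (rule add_mono)
  also have "\<dots> = (real N * real N + real N) * ?b"
    by (simp add: distrib_right)
  \<comment> \<open>The crude \<open>N * N + N \<le> (N + 1)\<^sup>2\<close> in place of the number
    of pairs \<open>N * (N - 1) / 2\<close>; the lost factor does not affect the rate.\<close>
  also have "\<dots> \<le> real (Suc N) * real (Suc N) * ?b"
    using b by (intro mult_right_mono) (auto simp: algebra_simps)
  finally have "(\<Sum>m<Suc N. \<Sum>m'<m. \<Sum>e\<in>E. \<omega> e * of_bool (\<forall>j\<in>J e. ?f m j = ?f m' j))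
      \<le> real (Suc N) * real (Suc N) * ?b" .
  moreover have "\<forall>m<Suc N. \<forall>j<n. ?f m j \<in> X"
    using f c by (auto simp: less_Suc_eq PiE_iff)
  ultimately show ?case by blast
qed

definition consistent :: "nat \<Rightarrow> (nat \<Rightarrow> 'x) \<Rightarrow> (nat \<Rightarrow> 'x option) \<Rightarrow> bool" where
  "consistent n c y \<longleftrightarrow> (\<forall>j<n. y j \<noteq> None \<longrightarrow> y j = Some (c j))"

text \<open>Choosing the least candidate lets an error at \<open>m\<close> be blamed on some
  \<open>m' < m\<close>, matching the ordered pairs counted in \<open>exists_code\<close>. The
  default 0 keeps the decision a valid message when \<open>0 < N\<close>.\<close>

definition least_consistent :: "nat \<Rightarrow> nat \<Rightarrow> (nat \<Rightarrow> nat \<Rightarrow> 'x) \<Rightarrow> (nat \<Rightarrow> 'x option) \<Rightarrow> nat" where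
  "least_consistent n N f y =
    (if \<exists>m<N. consistent n (f m) y then LEAST m. consistent n (f m) y else 0)"

lemma consistent_mask: "consistent n c (mask e x) \<longleftrightarrow> (\<forall>j\<in>survivors n e. c j = x j)"
  by (auto simp: consistent_def mask_def survivors_def)

lemma least_consistent_less: "0 < N \<Longrightarrow> least_consistent n N f y < N"
  unfolding least_consistent_def by (auto intro: le_less_trans[OF Least_le])

text \<open>A message is always consistent with its own masked codeword, so a wrong decision is a
  smaller message whose codeword agrees on all survivors.\<close>

lemma least_consistent_wrong_count:
  "real (card {m\<in>{..<N}. least_consistent n N f (mask e (f m)) \<noteq> m})
    \<le> (\<Sum>m<N. \<Sum>m'<m. of_bool (\<forall>j\<in>survivors n e. f m j = f m' j))"
proof -
  have "real (card {m\<in>{..<N}. least_consistent n N f (mask e (f m)) \<noteq> m})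
      = (\<Sum>m<N. of_bool (least_consistent n N f (mask e (f m)) \<noteq> m))"
    by (simp add: of_bool_def sum.If_cases Int_def)
  also have "\<dots> \<le> (\<Sum>m<N. \<Sum>m'<m. of_bool (\<forall>j\<in>survivors n e. f m j = f m' j))"
  proof (rule sum_mono)
    fix m assume m: "m \<in> {..<N}"
    let ?y = "mask e (f m)"
    show "of_bool (least_consistent n N f ?y \<noteq> m)
      \<le> (\<Sum>m'<m. of_bool (\<forall>j\<in>survivors n e. f m j = f m' j) :: real)"
    proof (cases "least_consistent n N f ?y = m")
      case False
      have self: "consistent n (f m) ?y" by (simp add: consistent_mask)
      define m' where "m' = (LEAST m. consistent n (f m) ?y)"
      have "consistent n (f m') ?y" unfolding m'_def by (rule LeastI[of _ m]) (rule self)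
      then have agree: "\<forall>j\<in>survivors n e. f m j = f m' j" by (auto simp: consistent_mask)
      have "m' \<le> m" unfolding m'_def by (rule Least_le) (rule self)
      moreover have "m' \<noteq> m"
      proof -
        have "\<exists>m<N. consistent n (f m) ?y" using self m by blast
        then have "least_consistent n N f ?y = m'" by (simp only: least_consistent_def m'_def if_True)
        with False show ?thesis by simp
      qed
      ultimately have "m' \<in> {..<m}" by simp
      then have "of_bool (\<forall>j\<in>survivors n e. f m j = f m' j)
          \<le> (\<Sum>m'<m. of_bool (\<forall>j\<in>survivors n e. f m j = f m' j) :: real)"
        by (intro member_le_sum) auto
      then show ?thesis using agree False by simp
    qed (simp add: sum_nonneg)
  qed
  finally show ?thesis .
qed

section \<open>Capacity\<close>

text \<open>Linearises \<open>min(N, x^k) / N\<close> in \<open>k\<close>: either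
  \<open>x^k \<le> \<eta> * N\<close>, and the fraction is at most \<open>\<eta>\<close>, or
  \<open>k * ln x\<close> exceeds \<open>ln (\<eta> * N)\<close>, and the right side is at least 1.
  Averaging then needs only the mean of \<open>k\<close>.\<close>

lemma correct_fraction_le:
  fixes c N \<eta> :: real and x k :: nat
  assumes c: "c \<le> N" "c \<le> real x ^ k" and N: "0 < N" and \<eta>: "0 < \<eta>" "1 < \<eta> * N" and x: "1 \<le> x"
  shows "c / N \<le> \<eta> + real k * (ln x / ln (\<eta> * N))"
proof -
  have L: "0 < ln (\<eta> * N)" using \<eta> by simp
  have lnx: "0 \<le> ln (real x)" using x by simp
  show ?thesis
  proof (cases "real x ^ k \<le> \<eta> * N")
    case True
    then have "c / N \<le> \<eta>" using c N by (simp add: field_simps)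
    moreover have "0 \<le> real k * (ln x / ln (\<eta> * N))" using L lnx by simp
    ultimately show ?thesis by simp
  next
    case False
    then have "ln (\<eta> * N) \<le> ln (real x ^ k)" using \<eta> x by (intro ln_mono) auto
    also have "\<dots> = real k * ln x" using x by (simp add: ln_realpow)
    finally have "1 \<le> real k * (ln x / ln (\<eta> * N))" using L by (simp add: field_simps)
    moreover have "c / N \<le> 1" using c N by simp
    ultimately show ?thesis using \<eta> by linarith
  qed
qed

lemma restrict_measurable_PiM:
  fixes F :: "'a \<Rightarrow> nat \<Rightarrow> real"
  assumes "\<And>i. (\<lambda>\<omega>. F \<omega> i) \<in> borel_measurable M"
  shows "(\<lambda>\<omega>. restrict (F \<omega>) I) \<in> measurable M (\<Pi>\<^sub>M i\<in>I. borel)"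
  using assms by (intro measurable_restrict) auto

context queue
begin

abbreviation "p \<equiv> \<lambda>w :: real. 1 - exp (- \<kappa> * w)"
abbreviation "W \<omega> \<equiv> waiting (fst \<omega>) (snd \<omega>)"

lemma p_bounds: "0 \<le> p (W \<omega> j)" "p (W \<omega> j) \<le> 1"
  using exp_le_1[OF waiting_nonneg] by simp_all

section \<open>The error probability as an average over erasure patterns\<close>

definition observation :: "nat \<Rightarrow> (nat \<Rightarrow> real) \<times> (nat \<Rightarrow> real) \<Rightarrow> (nat \<Rightarrow> real) \<times> (nat \<Rightarrow> real)" where
  "observation n \<omega> = (restrict (arrival (fst \<omega>)) {..<n}, restrict (service_start (fst \<omega>) (snd \<omega>)) {..<n})"

lemma service_start_eq: "service_start t s j = arrival t j + waiting t s j"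
  by (simp add: waiting_def)

lemma arrival_measurable_P[measurable]: "(\<lambda>\<omega>. arrival (fst \<omega>) j) \<in> borel_measurable P"
  by (rule arrival_measurable) simp

lemma observation_measurable[measurable]:
  "observation n \<in> measurable P ((\<Pi>\<^sub>M j\<in>{..<n}. borel) \<Otimes>\<^sub>M (\<Pi>\<^sub>M j\<in>{..<n}. borel))"
  unfolding observation_def
  by (intro measurable_Pair restrict_measurable_PiM) (simp_all add: service_start_eq)

definition wrong :: "nat \<Rightarrow> nat set \<Rightarrow> (nat \<Rightarrow> nat \<Rightarrow> 'x) \<Rightarrow> ((nat \<Rightarrow> 'x option) \<Rightarrow> (nat \<Rightarrow> real) \<times> (nat \<Rightarrow> real) \<Rightarrow> nat)
    \<Rightarrow> (nat \<Rightarrow> bool) \<Rightarrow> (nat \<Rightarrow> real) \<times> (nat \<Rightarrow> real) \<Rightarrow> real" where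
  "wrong n M f g e \<omega> = card {m\<in>M. g (mask e (f m)) (observation n \<omega>) \<noteq> m} / card M"

lemma wrong_bounds: "0 \<le> wrong n M f g e \<omega>" "finite M \<Longrightarrow> wrong n M f g e \<omega> \<le> 1"
proof -
  show "0 \<le> wrong n M f g e \<omega>" by (simp add: wrong_def)
  assume M: "finite M"
  have "card {m\<in>M. g (mask e (f m)) (observation n \<omega>) \<noteq> m} \<le> card M"
    using M by (intro card_mono) auto
  then show "wrong n M f g e \<omega> \<le> 1"
    unfolding wrong_def by (intro divide_le_eq_1[THEN iffD2]) auto
qed

lemma wrong_measurable:
  assumes M: "finite M"
    and g: "\<forall>y. g y \<in> (\<Pi>\<^sub>M j\<in>{..<n}. borel) \<Otimes>\<^sub>M (\<Pi>\<^sub>M j\<in>{..<n}. borel) \<rightarrow>\<^sub>M count_space M"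
  shows "wrong n M f g e \<in> borel_measurable P"
proof -
  have "(\<lambda>\<omega>. of_bool (g (mask e (f m)) (observation n \<omega>) \<noteq> m) :: real) \<in> borel_measurable P" for m
  proof (rule measurable_compose[where N = "count_space M"])
    show "(\<lambda>\<omega>. g (mask e (f m)) (observation n \<omega>)) \<in> P \<rightarrow>\<^sub>M count_space M"
      using g by (intro measurable_compose[OF observation_measurable]) auto
  qed simp
  moreover have "wrong n M f g e = (\<lambda>\<omega>. (\<Sum>m\<in>M. of_bool (g (mask e (f m)) (observation n \<omega>) \<noteq> m)) / card M)"
    using M by (simp add: fun_eq_iff wrong_def of_bool_def sum.If_cases Int_def)
  ultimately show ?thesis
    by (simp only:) (intro borel_measurable_divide borel_measurable_sum borel_measurable_const)
qed

definition weight :: "nat \<Rightarrow> (nat \<Rightarrow> bool) \<Rightarrow> (nat \<Rightarrow> real) \<times> (nat \<Rightarrow> real) \<Rightarrow> real" where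
  "weight n e \<omega> = pmf (erasures p n (W \<omega>)) e"

lemma weight_measurable[measurable]:
  assumes "e \<in> patterns n"
  shows "weight n e \<in> borel_measurable P"
proof -
  have "weight n e = (\<lambda>\<omega>. \<Prod>j<n. if e j then p (W \<omega> j) else 1 - p (W \<omega> j))"
    using pmf_erasures[where p = p and w = "W \<omega>" for \<omega>, OF assms p_bounds] by (simp add: weight_def fun_eq_iff)
  moreover have "(\<lambda>\<omega>. if e j then p (W \<omega> j) else 1 - p (W \<omega> j)) \<in> borel_measurable P" for j
    by (cases "e j") simp_all
  ultimately show ?thesis
    by (simp only:) (rule borel_measurable_prod)
qed

lemma weight_bounds: "0 \<le> weight n e \<omega>" "weight n e \<omega> \<le> 1"
  by (simp_all add: weight_def pmf_le_1)

lemma sum_weight: "(\<Sum>e\<in>patterns n. weight n e \<omega> * f e) = measure_pmf.expectation (erasures p n (W \<omega>)) f" for f :: "_ \<Rightarrow> real"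
  by (simp add: weight_def expectation_erasures)

lemma sum_weight_1: "(\<Sum>e\<in>patterns n. weight n e \<omega>) = 1"
  using sum_weight[of n \<omega> "\<lambda>_. 1"] by simp

lemma sum_weight_survivors:
  "(\<Sum>e\<in>patterns n. weight n e \<omega> * real (card (survivors n e))) = (\<Sum>j<n. exp (- \<kappa> * W \<omega> j))"
  unfolding sum_weight by (subst survivors_mean) (use p_bounds in auto)

lemma sum_weight_variance:
  "(\<Sum>e\<in>patterns n. weight n e \<omega> * (real (card (survivors n e)) - (\<Sum>j<n. exp (- \<kappa> * W \<omega> j)))\<^sup>2) \<le> n"
  unfolding sum_weight using survivors_variance[of p "W \<omega>" n] p_bounds by simp

lemma error_prob_eq:
  assumes M: "finite M" "M \<noteq> {}"
  shows "error_prob p FA FS n M f g = (\<integral>\<omega>. (\<Sum>e\<in>patterns n. weight n e \<omega> * wrong n M f g e \<omega>) \<partial>P)"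
proof -
  have "measure_pmf.prob
          (bind_pmf (pmf_of_set M) (\<lambda>m.
             map_pmf (\<lambda>y. (m, g y (restrict (arrival t) {..<n}, restrict (service_start t s) {..<n})))
               (channel_pmf p n (waiting t s) (f m))))
          {(m, m'). m' \<noteq> m} = (\<Sum>e\<in>patterns n. weight n e (t, s) * wrong n M f g e (t, s))" for t s
    unfolding conditional_error_eq[OF M, where g = "\<lambda>y. g y (restrict (arrival t) {..<n}, restrict (service_start t s) {..<n})"]
    by (simp add: weight_def wrong_def observation_def)
  then show ?thesis by (simp add: error_prob_def split_beta')
qed

lemma weight_wrong_integrable:
  assumes M: "finite M" and e: "e \<in> patterns n"
    and g: "\<forall>y. g y \<in> (\<Pi>\<^sub>M j\<in>{..<n}. borel) \<Otimes>\<^sub>M (\<Pi>\<^sub>M j\<in>{..<n}. borel) \<rightarrow>\<^sub>M count_space M"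
  shows "integrable P (\<lambda>\<omega>. weight n e \<omega> * wrong n M f g e \<omega>)"
proof (rule P.integrable_const_bound[where B = 1])
  show "AE \<omega> in P. norm (weight n e \<omega> * wrong n M f g e \<omega>) \<le> 1"
  proof (rule AE_I2)
    fix \<omega>
    show "norm (weight n e \<omega> * wrong n M f g e \<omega>) \<le> 1"
      using mult_le_one[OF weight_bounds(2)[of n e \<omega>] wrong_bounds(1)[of n M f g e \<omega>] wrong_bounds(2)[OF M]]
        weight_bounds(1)[of n e \<omega>] wrong_bounds(1)[of n M f g e \<omega>]
      by simp
  qed
  show "(\<lambda>\<omega>. weight n e \<omega> * wrong n M f g e \<omega>) \<in> borel_measurable P"
    using weight_measurable[OF e] wrong_measurable[OF M g] by (rule borel_measurable_times)
qed

lemma survival_integrable: "integrable P (\<lambda>\<omega>. \<Sum>j<n. exp (- \<kappa> * W \<omega> j))"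
  by (intro Bochner_Integration.integrable_sum P.integrable_const_bound[where B = 1])
     (use exp_le_1[OF waiting_nonneg] in auto)

section \<open>The converse\<close>

text \<open>Takes the place of Fano's inequality. Right messages are counted for a fixed pattern and
  a fixed timing, so a decoder that sees the timing gains nothing; the linear bound is then averaged
  over both.\<close>

lemma code_size_bound:
  assumes code: "is_code informed X FA FS n R T M f g" and X: "finite X" "X \<noteq> {}"
    and err: "error_prob p FA FS n M f g < \<epsilon>" and \<eta>: "0 < \<eta>" "\<epsilon> + \<eta> < 1"
  shows "(ln (card M) + ln \<eta>) * (1 - \<epsilon> - \<eta>) \<le> ln (card X) * (\<integral>\<omega>. (\<Sum>j<n. exp (- \<kappa> * W \<omega> j)) \<partial>P)"
proof -
  from code have M: "finite M" and cM: "real (card M) = 2 powr (real n * R)"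
    and f: "\<forall>m\<in>M. \<forall>j<n. f m j \<in> X"
    and g: "\<forall>y. g y \<in> (\<Pi>\<^sub>M j\<in>{..<n}. borel) \<Otimes>\<^sub>M (\<Pi>\<^sub>M j\<in>{..<n}. borel) \<rightarrow>\<^sub>M count_space M"
    by (auto simp: is_code_def)
  have cpos: "0 < real (card M)" by (simp add: cM)
  then have M0: "M \<noteq> {}" by auto
  have x: "1 \<le> card X" using X by (simp add: Suc_le_eq card_gt_0_iff)
  then have lnx: "0 \<le> ln (card X)" by simp
  let ?E = "\<integral>\<omega>. (\<Sum>j<n. exp (- \<kappa> * W \<omega> j)) \<partial>P"
  have E0: "0 \<le> ?E" by (intro integral_nonneg_AE AE_I2 sum_nonneg) auto
  show ?thesis
  proof (cases "1 < \<eta> * card M")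
    \<comment> \<open>A code this small makes the left side nonpositive.\<close>
    case False
    then have "ln (\<eta> * card M) \<le> 0" using \<eta> cpos by simp
    then have "ln (card M) + ln \<eta> \<le> 0" using \<eta> cpos by (simp add: ln_mult)
    then have "(ln (card M) + ln \<eta>) * (1 - \<epsilon> - \<eta>) \<le> 0"
      using \<eta> by (intro mult_nonpos_nonneg) auto
    also have "0 \<le> ln (card X) * ?E" using lnx E0 by simp
    finally show ?thesis .
  next
    case True
    define L where "L = ln (\<eta> * card M)"
    have L: "0 < L" using True by (simp add: L_def)
    have Leq: "L = ln (card M) + ln \<eta>" using \<eta> cpos by (simp add: L_def ln_mult)
    have one: "1 - wrong n M f g e \<omega> \<le> \<eta> + real (card (survivors n e)) * (ln (card X) / L)"
      if e: "e \<in> patterns n" for e \<omega>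
    proof -
      let ?C = "{m\<in>M. g (mask e (f m)) (observation n \<omega>) = m}"
      let ?D = "{m\<in>M. g (mask e (f m)) (observation n \<omega>) \<noteq> m}"
      have "card M = card ?C + card ?D"
        using M by (subst card_Un_disjoint[symmetric]) (auto intro!: arg_cong[where f = card])
      then have "1 - wrong n M f g e \<omega> = card ?C / card M"
        using cpos by (simp add: wrong_def field_simps)
      also have "\<dots> \<le> \<eta> + real (card (survivors n e)) * (ln (card X) / L)"
        unfolding L_def
      proof (rule correct_fraction_le)
        show "real (card ?C) \<le> card M" using M by (auto intro!: card_mono)
        show "real (card ?C) \<le> real (card X) ^ card (survivors n e)"
          using correct_count_le[OF X(1) f e, of "\<lambda>y. g y (observation n \<omega>)"]
          by (simp only: of_nat_power[symmetric] of_nat_le_iff)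
      qed (use cpos \<eta> True x in auto)
      finally show ?thesis .
    qed
    have "1 - \<epsilon> \<le> 1 - error_prob p FA FS n M f g" using err by simp
    also have "\<dots> = (\<integral>\<omega>. 1 - (\<Sum>e\<in>patterns n. weight n e \<omega> * wrong n M f g e \<omega>) \<partial>P)"
      unfolding error_prob_eq[OF M M0]
      using weight_wrong_integrable[OF M _ g] P.prob_space by simp
    also have "\<dots> \<le> (\<integral>\<omega>. \<eta> + (\<Sum>j<n. exp (- \<kappa> * W \<omega> j)) * (ln (card X) / L) \<partial>P)"
    proof (rule integral_mono)
      show "integrable P (\<lambda>\<omega>. 1 - (\<Sum>e\<in>patterns n. weight n e \<omega> * wrong n M f g e \<omega>))"
        using weight_wrong_integrable[OF M _ g] by simp
      show "integrable P (\<lambda>\<omega>. \<eta> + (\<Sum>j<n. exp (- \<kappa> * W \<omega> j)) * (ln (card X) / L))"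
        using survival_integrable[of n] by simp
      fix \<omega>
      have "1 - (\<Sum>e\<in>patterns n. weight n e \<omega> * wrong n M f g e \<omega>)
          = (\<Sum>e\<in>patterns n. weight n e \<omega> * (1 - wrong n M f g e \<omega>))"
        by (simp add: right_diff_distrib sum_subtractf sum_weight_1)
      also have "\<dots> \<le> (\<Sum>e\<in>patterns n. weight n e \<omega> * (\<eta> + real (card (survivors n e)) * (ln (card X) / L)))"
        using one weight_bounds by (intro sum_mono mult_left_mono) auto
      also have "\<dots> = (\<Sum>e\<in>patterns n. weight n e \<omega>) * \<eta>
          + (\<Sum>e\<in>patterns n. weight n e \<omega> * real (card (survivors n e))) * (ln (card X) / L)"
        by (simp only: distrib_left sum.distrib sum_distrib_right mult.assoc)
      also have "\<dots> = \<eta> + (\<Sum>j<n. exp (- \<kappa> * W \<omega> j)) * (ln (card X) / L)"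
        by (simp only: sum_weight_1 sum_weight_survivors mult_1)
      finally show "1 - (\<Sum>e\<in>patterns n. weight n e \<omega> * wrong n M f g e \<omega>)
          \<le> \<eta> + (\<Sum>j<n. exp (- \<kappa> * W \<omega> j)) * (ln (card X) / L)" .
    qed
    also have "\<dots> = \<eta> + ?E * (ln (card X) / L)"
      using survival_integrable[of n] P.prob_space by simp
    finally have "1 - \<epsilon> - \<eta> \<le> ?E * (ln (card X) / L)" by simp
    then have "(1 - \<epsilon> - \<eta>) * L \<le> ?E * ln (card X)"
      using L by (simp add: field_simps)
    then show ?thesis by (simp add: Leq mult.commute)
  qed
qed

text \<open>The last symbol has index \<open>n - 1\<close>: its arrival is a sum of \<open>n\<close>
  interarrival times, and its own service adds the unit mean.\<close>

lemma completion_time: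
  assumes n: "0 < n"
  shows "(\<integral>\<^sup>+ (t, s). ennreal (service_start t s (n - 1) + s (n - 1)) \<partial>P)
    = ennreal (n / l + (\<integral>\<omega>. W \<omega> (n - 1) \<partial>P) + 1)"
proof -
  let ?c = "\<lambda>\<omega>. (\<Sum>i\<le>n - 1. fst \<omega> i) + W \<omega> (n - 1) + snd \<omega> (n - 1)"
  have Wint: "integrable P (\<lambda>\<omega>. W \<omega> (n - 1))"
    using waiting_sublinear[of 1] by (metis zero_less_one)
  note A = interarrival_integral[OF FA_integrable] and S = service_integral[OF FS_integrable]
  have "(\<integral>\<^sup>+ (t, s). ennreal (service_start t s (n - 1) + s (n - 1)) \<partial>P) = (\<integral>\<^sup>+\<omega>. ennreal (?c \<omega>) \<partial>P)"
    by (simp add: service_start_eq arrival_def split_beta')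
  also have "\<dots> = ennreal (\<integral>\<omega>. ?c \<omega> \<partial>P)"
  proof (rule nn_integral_eq_integral)
    show "integrable P ?c" using A S Wint by simp
    have 1: "AE \<omega> in P. 0 \<le> fst \<omega> i" for i
      using exponential_distribution_moments(3)[OF l(1)]
      by (intro AE_distrD[OF component_measurable'(1)[of i]]) (simp only: distr_interarrival)
    have 2: "AE \<omega> in P. 0 \<le> snd \<omega> i" for i
      using FS_nonneg
      by (intro AE_distrD[OF component_measurable'(2)[of i]]) (simp only: distr_service)
    have "AE \<omega> in P. \<forall>i. 0 \<le> fst \<omega> i" using 1 by (simp add: AE_all_countable)
    then show "AE \<omega> in P. 0 \<le> ?c \<omega>"
      using 2[of "n - 1"] by eventually_elim (auto intro!: add_nonneg_nonneg sum_nonneg waiting_nonneg)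
  qed
  also have "(\<integral>\<omega>. ?c \<omega> \<partial>P) = n / l + (\<integral>\<omega>. W \<omega> (n - 1) \<partial>P) + 1"
    using A S Wint n by (simp add: FA_integral FS_integral)
  finally show ?thesis .
qed


lemma survival_mean_le:
  assumes "0 < \<theta>"
  obtains n0 where "\<And>n. n0 \<le> n \<Longrightarrow> (\<integral>\<omega>. (\<Sum>j<n. exp (- \<kappa> * W \<omega> j)) \<partial>P) \<le> real n * (survival + \<theta>)"
proof -
  let ?S = "\<lambda>n \<omega>. \<Sum>j<n. exp (- \<kappa> * W \<omega> j)"
  obtain C where C: "0 \<le> C" "\<And>n. integrable P (\<lambda>\<omega>. \<bar>?S n \<omega> - n * survival\<bar>)"
    "\<And>n. (\<integral>\<omega>. \<bar>?S n \<omega> - n * survival\<bar> \<partial>P) \<le> real n * (\<theta> / 2) + C"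
    using survival_average[OF half_gt_zero[OF assms]] by blast
  obtain n0 :: nat where n0: "2 * C / \<theta> \<le> n0" using real_arch_simple by blast
  have "(\<integral>\<omega>. ?S n \<omega> \<partial>P) \<le> real n * (survival + \<theta>)" if n: "n0 \<le> n" for n
  proof -
    have "2 * C / \<theta> \<le> n" using n0 n by linarith
    then have "C \<le> real n * (\<theta> / 2)" using assms by (simp add: field_simps)
    have "(\<integral>\<omega>. ?S n \<omega> \<partial>P) \<le> (\<integral>\<omega>. n * survival + \<bar>?S n \<omega> - n * survival\<bar> \<partial>P)"
      using C(2)[of n] survival_integrable[of n] by (intro integral_mono) auto
    also have "\<dots> = n * survival + (\<integral>\<omega>. \<bar>?S n \<omega> - n * survival\<bar> \<partial>P)"
      using C(2)[of n] P.prob_space by simp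
    also have "\<dots> \<le> n * survival + (real n * (\<theta> / 2) + real n * (\<theta> / 2))"
      using C(3)[of n] \<open>C \<le> real n * (\<theta> / 2)\<close> by linarith
    also have "\<dots> = real n * (survival + \<theta>)" by (simp add: distrib_left)
    finally show ?thesis .
  qed
  then show ?thesis using that by blast
qed

text \<open>The last arrival alone has mean \<open>n / l\<close>; waiting and service only add to
  it.\<close>

lemma code_time_gt:
  assumes "is_code informed X FA FS n R T M f g"
  shows "real n / l < T"
proof -
  have n: "0 < n" and T: "(\<integral>\<^sup>+ (t, s). ennreal (service_start t s (n - 1) + s (n - 1)) \<partial>P) < ennreal T"
    using assms by (auto simp: is_code_def)
  have W: "0 \<le> (\<integral>\<omega>. W \<omega> (n - 1) \<partial>P)" by (intro integral_nonneg_AE AE_I2 waiting_nonneg)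
  have "n / l + (\<integral>\<omega>. W \<omega> (n - 1) \<partial>P) + 1 < T"
    using T l W unfolding completion_time[OF n] by (subst (asm) ennreal_less_iff) auto
  then show ?thesis using W by linarith
qed

text \<open>A single \<open>\<theta>\<close> serves as error level, rate slack, the
  \<open>\<eta>\<close> of \<open>code_size_bound\<close> and the survival tolerance. One block
  length beyond the thresholds is enough, since the resulting bound no longer involves
  \<open>n\<close>.\<close>

lemma achievable_rate_bound:
  assumes ach: "achievable informed X p FA FS R" and X: "finite X" "X \<noteq> {}"
    and \<theta>: "0 < \<theta>" "\<theta> < 1 / 4"
  shows "R \<le> \<theta> + l * (log 2 (card X) * (survival + \<theta>) / (1 - 2 * \<theta>) + \<theta>)"
proof -
  let ?B = "log 2 (card X) * (survival + \<theta>) / (1 - 2 * \<theta>) + \<theta>"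
  have x: "1 \<le> card X" using X by (simp add: Suc_le_eq card_gt_0_iff)
  have B: "0 \<le> ?B"
    using x \<theta> survival_pos by (intro add_nonneg_nonneg divide_nonneg_nonneg mult_nonneg_nonneg) auto
  obtain n0 where n0: "\<And>n. n0 \<le> n \<Longrightarrow> (\<integral>\<omega>. (\<Sum>j<n. exp (- \<kappa> * W \<omega> j)) \<partial>P) \<le> real n * (survival + \<theta>)"
    using survival_mean_le[OF \<theta>(1)] by blast
  \<comment> \<open>From here on \<open>- log 2 \<theta> \<le> n * \<theta>\<close>, which absorbs
    the additive \<open>ln \<eta>\<close> of \<open>code_size_bound\<close>.\<close>
  obtain n1 :: nat where n1: "- log 2 \<theta> / \<theta> \<le> n1" using real_arch_simple by blast
  have "\<forall>\<^sub>F n in sequentially. \<exists>R' T M f g. is_code informed X FA FS n R' T M f g \<and>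
          error_prob p FA FS n M f g < \<theta> \<and> real n * R' / T > R - \<theta>"
    using ach \<theta> unfolding achievable_def by auto
  with eventually_ge_at_top[of n0] eventually_ge_at_top[of n1]
  have "\<forall>\<^sub>F n in sequentially. n0 \<le> n \<and> n1 \<le> n \<and> (\<exists>R' T M f g. is_code informed X FA FS n R' T M f g \<and>
          error_prob p FA FS n M f g < \<theta> \<and> real n * R' / T > R - \<theta>)"
    by eventually_elim (intro conjI)
  from eventually_happens'[OF sequentially_bot this] obtain n R' T M f g where n: "n0 \<le> n" "n1 \<le> n" and code: "is_code informed X FA FS n R' T M f g"
    and err: "error_prob p FA FS n M f g < \<theta>" and rate: "R - \<theta> < real n * R' / T"
    by blast
  have n_pos: "0 < n" and cM: "real (card M) = 2 powr (real n * R')"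
    using code by (auto simp: is_code_def)
  have T: "real n / l < T" by (rule code_time_gt[OF code])
  moreover have "0 < real n / l" using n_pos l by simp
  ultimately have T0: "0 < T" by linarith
  have "(ln (card M) + ln \<theta>) * (1 - 2 * \<theta>) \<le> ln (card X) * (real n * (survival + \<theta>))"
  proof -
    have "(ln (card M) + ln \<theta>) * (1 - \<theta> - \<theta>) \<le> ln (card X) * (\<integral>\<omega>. (\<Sum>j<n. exp (- \<kappa> * W \<omega> j)) \<partial>P)"
      using \<theta> by (intro code_size_bound[OF code X err]) auto
    also have "\<dots> \<le> ln (card X) * (real n * (survival + \<theta>))"
      using n0[OF n(1)] x by (intro mult_left_mono) auto
    finally show ?thesis by simp
  qed
  then have "(ln (card M) + ln \<theta>) * (1 - 2 * \<theta>) / ln 2 \<le> ln (card X) * (real n * (survival + \<theta>)) / ln 2"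
    by (rule divide_right_mono) simp
  moreover have "(ln (card M) + ln \<theta>) * (1 - 2 * \<theta>) / ln 2 = (real n * R' + log 2 \<theta>) * (1 - 2 * \<theta>)"
    by (simp add: log_def cM ln_powr field_simps)
  ultimately have "(real n * R' + log 2 \<theta>) * (1 - 2 * \<theta>) \<le> log 2 (card X) * (real n * (survival + \<theta>))"
    by (simp add: log_def)
  then have "real n * R' + log 2 \<theta> \<le> log 2 (card X) * (real n * (survival + \<theta>)) / (1 - 2 * \<theta>)"
    using \<theta> by (simp add: pos_le_divide_eq)
  also have "\<dots> = real n * (log 2 (card X) * (survival + \<theta>) / (1 - 2 * \<theta>))"
    by (simp add: mult.left_commute)
  finally have "real n * R' + log 2 \<theta> \<le> \<dots>" .
  moreover have "- log 2 \<theta> / \<theta> \<le> n" using n1 n by linarith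
  then have "- log 2 \<theta> \<le> real n * \<theta>" using \<theta> by (simp add: field_simps)
  ultimately have "real n * R' \<le> real n * ?B"
    unfolding distrib_left by linarith
  then have "real n * R' / T \<le> real n * ?B / T"
    using T0 by (intro divide_right_mono) auto
  also have "\<dots> \<le> real n * ?B / (real n / l)"
    using T n_pos l B by (intro divide_left_mono mult_nonneg_nonneg mult_pos_pos T0) auto
  also have "\<dots> = l * ?B" using n_pos l by simp
  finally show ?thesis using rate by linarith
qed

lemma achievable_le:
  assumes ach: "achievable informed X p FA FS R" and X: "finite X" "X \<noteq> {}"
  shows "R \<le> l * survival * log 2 (card X)"
proof -
  let ?f = "\<lambda>\<theta>. \<theta> + l * (log 2 (card X) * (survival + \<theta>) / (1 - 2 * \<theta>) + \<theta>)"
  have "(?f \<longlongrightarrow> 0 + l * (log 2 (card X) * (survival + 0) / (1 - 2 * 0) + 0)) (at_right 0)"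
    by (intro tendsto_intros) auto
  moreover have "\<forall>\<^sub>F \<theta> in at_right 0. R \<le> ?f \<theta>"
  proof -
    have "\<forall>\<^sub>F \<theta> in at_right 0. \<theta> \<in> {0<..<1 / 4 :: real}"
      by (rule eventually_at_right_real) simp
    then show ?thesis by eventually_elim (use achievable_rate_bound[OF ach X] in auto)
  qed
  ultimately have "R \<le> 0 + l * (log 2 (card X) * (survival + 0) / (1 - 2 * 0) + 0)"
    by (rule tendsto_lowerbound) simp
  then show ?thesis by (simp add: mult_ac)
qed

end

section \<open>Achievability\<close>

text \<open>For \<open>k\<close> to fall \<open>2 * d\<close> below \<open>c\<close>, either
  \<open>\<mu>\<close> is at least \<open>d\<close> away from \<open>c\<close> or \<open>k\<close>
  at least \<open>d\<close> away from \<open>\<mu>\<close>. The first event is charged by Markov, as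
  only a first moment is available for it, the second by Chebyshev. In use, \<open>\<mu>\<close> is
  the mean of \<open>k\<close> given the timing.\<close>

lemma indicator_deviation_le:
  fixes k \<mu> c d :: real
  assumes "0 < d"
  shows "of_bool (k < c - 2 * d) \<le> \<bar>\<mu> - c\<bar> / d + (k - \<mu>)\<^sup>2 / d\<^sup>2"
proof (cases "k < c - 2 * d")
  case True
  show ?thesis
  proof (cases "d \<le> \<bar>\<mu> - c\<bar>")
    case True
    then have "1 \<le> \<bar>\<mu> - c\<bar> / d" using assms by simp
    moreover have "0 \<le> (k - \<mu>)\<^sup>2 / d\<^sup>2" by simp
    moreover have "of_bool (k < c - 2 * d) \<le> (1 :: real)" by simp
    ultimately show ?thesis by linarith
  next
    case False
    with True have "\<bar>d\<bar> \<le> \<bar>k - \<mu>\<bar>" using assms by linarith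
    then have "d\<^sup>2 \<le> (k - \<mu>)\<^sup>2" by (simp only: abs_le_square_iff)
    then have "1 \<le> (k - \<mu>)\<^sup>2 / d\<^sup>2" using assms by simp
    moreover have "0 \<le> \<bar>\<mu> - c\<bar> / d" using assms by simp
    moreover have "of_bool (k < c - 2 * d) \<le> (1 :: real)" by simp
    ultimately show ?thesis by linarith
  qed
next
  case False
  then show ?thesis using assms by simp
qed

context queue
begin

lemma weight_integrable: "e \<in> patterns n \<Longrightarrow> integrable P (weight n e)"
  by (rule P.integrable_const_bound[where B = 1]) (use weight_bounds in auto)

lemma few_survivors_le:
  assumes \<gamma>: "0 < \<gamma>" and \<epsilon>: "0 < \<epsilon>"
  obtains n0 where "\<And>n. n0 \<le> n \<Longrightarrow>
    (\<Sum>e\<in>patterns n. (\<integral>\<omega>. weight n e \<omega> \<partial>P) * of_bool (real (card (survivors n e)) < real n * (survival - 2 * \<gamma>))) < \<epsilon>"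
proof -
  let ?S = "\<lambda>n \<omega>. \<Sum>j<n. exp (- \<kappa> * W \<omega> j)"
  let ?b = "\<lambda>n e. of_bool (real (card (survivors n e)) < real n * (survival - 2 * \<gamma>)) :: real"
  \<comment> \<open>Makes the Markov term \<open>n * \<theta> / (n * \<gamma>)\<close> equal to
    \<open>\<epsilon> / 2\<close>.\<close>
  define \<theta> where "\<theta> = \<gamma> * \<epsilon> / 2"
  have \<theta>: "0 < \<theta>" using \<gamma> \<epsilon> by (simp add: \<theta>_def)
  obtain C where C: "0 \<le> C" "\<And>n. integrable P (\<lambda>\<omega>. \<bar>?S n \<omega> - n * survival\<bar>)"
    "\<And>n. (\<integral>\<omega>. \<bar>?S n \<omega> - n * survival\<bar> \<partial>P) \<le> real n * \<theta> + C"
    using survival_average[OF \<theta>] by blast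
  \<comment> \<open>Brings the terms of order \<open>1 / n\<close> below the other
    \<open>\<epsilon> / 2\<close>.\<close>
  obtain n1 :: nat where n1: "2 * (C / \<gamma> + 1 / \<gamma>\<^sup>2) / \<epsilon> < n1" using reals_Archimedean2 by blast
  have "(\<Sum>e\<in>patterns n. (\<integral>\<omega>. weight n e \<omega> \<partial>P) * ?b n e) < \<epsilon>" if n: "Suc n1 \<le> n" for n
  proof -
    have n_pos: "0 < real n" using n by simp
    have d: "0 < real n * \<gamma>" using n_pos \<gamma> by simp
    have "(\<Sum>e\<in>patterns n. (\<integral>\<omega>. weight n e \<omega> \<partial>P) * ?b n e) = (\<integral>\<omega>. (\<Sum>e\<in>patterns n. weight n e \<omega> * ?b n e) \<partial>P)"
      using weight_integrable by simp
    also have "\<dots> \<le> (\<integral>\<omega>. \<bar>?S n \<omega> - n * survival\<bar> / (real n * \<gamma>) + n / (real n * \<gamma>)\<^sup>2 \<partial>P)"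
    proof (rule integral_mono)
      show "integrable P (\<lambda>\<omega>. \<Sum>e\<in>patterns n. weight n e \<omega> * ?b n e)"
        using weight_integrable by simp
      show "integrable P (\<lambda>\<omega>. \<bar>?S n \<omega> - n * survival\<bar> / (real n * \<gamma>) + n / (real n * \<gamma>)\<^sup>2)"
        using C(2)[of n] by simp
      fix \<omega>
      let ?a = "\<bar>?S n \<omega> - n * survival\<bar> / (real n * \<gamma>)"
      let ?v = "\<lambda>e. (real (card (survivors n e)) - ?S n \<omega>)\<^sup>2"
      have "?b n e \<le> ?a + ?v e / (real n * \<gamma>)\<^sup>2" for e
        using indicator_deviation_le[OF d, of "real (card (survivors n e))" "n * survival" "?S n \<omega>"]
        by (simp add: right_diff_distrib mult.left_commute)
      then have "(\<Sum>e\<in>patterns n. weight n e \<omega> * ?b n e)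
          \<le> (\<Sum>e\<in>patterns n. weight n e \<omega> * (?a + ?v e / (real n * \<gamma>)\<^sup>2))"
        using weight_bounds by (intro sum_mono mult_left_mono) auto
      also have "\<dots> = (\<Sum>e\<in>patterns n. weight n e \<omega>) * ?a + (\<Sum>e\<in>patterns n. weight n e \<omega> * ?v e) / (real n * \<gamma>)\<^sup>2"
        by (simp only: distrib_left sum.distrib sum_distrib_right sum_divide_distrib times_divide_eq_right)
      also have "\<dots> \<le> ?a + n / (real n * \<gamma>)\<^sup>2"
        unfolding sum_weight_1 mult_1 by (intro add_left_mono divide_right_mono sum_weight_variance) simp
      finally show "(\<Sum>e\<in>patterns n. weight n e \<omega> * ?b n e) \<le> ?a + n / (real n * \<gamma>)\<^sup>2" .
    qed
    also have "\<dots> = (\<integral>\<omega>. \<bar>?S n \<omega> - n * survival\<bar> \<partial>P) / (real n * \<gamma>) + n / (real n * \<gamma>)\<^sup>2"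
      using C(2)[of n] P.prob_space by simp
    also have "\<dots> \<le> (real n * \<theta> + C) / (real n * \<gamma>) + n / (real n * \<gamma>)\<^sup>2"
      using C(3)[of n] d by (intro add_right_mono divide_right_mono) auto
    also have "\<dots> = \<epsilon> / 2 + (C / \<gamma> + 1 / \<gamma>\<^sup>2) / n"
      using n_pos \<gamma> by (simp add: \<theta>_def field_simps power2_eq_square)
    also have "\<dots> < \<epsilon> / 2 + \<epsilon> / 2"
    proof -
      have "2 * (C / \<gamma> + 1 / \<gamma>\<^sup>2) / \<epsilon> < n" using n1 n by linarith
      then show ?thesis using n_pos \<epsilon> by (simp add: field_simps)
    qed
    finally show ?thesis by simp
  qed
  then show ?thesis using that by blast
qed

text \<open>The decoder ignores the timing, so the timing can be integrated out of the pattern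
  weights before the codebook is chosen: one codebook serves all timings. Patterns with fewer than
  \<open>k\<close> survivors are written off as errors.\<close>

lemma exists_code_error_le:
  assumes X: "finite X" "X \<noteq> {}" and K: "0 < K"
  obtains f :: "nat \<Rightarrow> nat \<Rightarrow> 'x" where "\<forall>m<K. \<forall>j<n. f m j \<in> X"
    and "error_prob p FA FS n {..<K} f (\<lambda>y _. least_consistent n K f y)
      \<le> (\<Sum>e\<in>patterns n. (\<integral>\<omega>. weight n e \<omega> \<partial>P) * of_bool (real (card (survivors n e)) < k))
        + real K * real (card X) powr (- k)"
proof -
  let ?w = "\<lambda>e. \<integral>\<omega>. weight n e \<omega> \<partial>P"
  let ?bad = "\<lambda>e. of_bool (real (card (survivors n e)) < k) :: real"
  \<comment> \<open>The greedy choice is run on good patterns only; there the agreement probability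
    is at most \<open>|X|^(-k)\<close>.\<close>
  let ?u = "\<lambda>e. ?w e * (1 - ?bad e)"
  have w0: "0 \<le> ?w e" for e using weight_bounds by simp
  have u0: "0 \<le> ?u e" for e using w0 by simp
  have w1: "(\<Sum>e\<in>patterns n. ?w e) = 1"
  proof -
    have "(\<Sum>e\<in>patterns n. ?w e) = (\<integral>\<omega>. (\<Sum>e\<in>patterns n. weight n e \<omega>) \<partial>P)"
      using weight_integrable by simp
    then show ?thesis by (simp add: sum_weight_1 P.prob_space)
  qed
  have x: "1 \<le> real (card X)" using X by (simp add: Suc_le_eq card_gt_0_iff)
  have "\<exists>f :: nat \<Rightarrow> nat \<Rightarrow> 'x. (\<forall>m<K. \<forall>j<n. f m j \<in> X) \<and>
    (\<Sum>m<K. \<Sum>m'<m. \<Sum>e\<in>patterns n. ?u e * of_bool (\<forall>j\<in>survivors n e. f m j = f m' j))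
      \<le> real K * real K * (\<Sum>e\<in>patterns n. ?u e / real (card X) ^ card (survivors n e))"
    by (rule exists_code[OF X finite_patterns u0 survivors_subset])
  then obtain f :: "nat \<Rightarrow> nat \<Rightarrow> 'x" where f: "\<forall>m<K. \<forall>j<n. f m j \<in> X"
    and cost: "(\<Sum>m<K. \<Sum>m'<m. \<Sum>e\<in>patterns n. ?u e * of_bool (\<forall>j\<in>survivors n e. f m j = f m' j))
      \<le> real K * real K * (\<Sum>e\<in>patterns n. ?u e / real (card X) ^ card (survivors n e))"
    by (elim exE conjE)
  let ?g = "\<lambda>y (_ :: (nat \<Rightarrow> real) \<times> (nat \<Rightarrow> real)). least_consistent n K f y"
  define v where "v e = real (card {m\<in>{..<K}. least_consistent n K f (mask e (f m)) \<noteq> m}) / K" for e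
  have v: "wrong n {..<K} f ?g e \<omega> = v e" for e \<omega> by (simp add: wrong_def v_def)
  have v1: "v e \<le> 1" for e using wrong_bounds(2)[of "{..<K}" n f ?g e undefined] unfolding v by simp
  have v2: "v e \<le> (\<Sum>m<K. \<Sum>m'<m. of_bool (\<forall>j\<in>survivors n e. f m j = f m' j)) / K" for e
    unfolding v_def by (intro divide_right_mono least_consistent_wrong_count) simp
  have "error_prob p FA FS n {..<K} f ?g = (\<Sum>e\<in>patterns n. ?w e * v e)"
    using K weight_integrable by (subst error_prob_eq) (auto simp: v)
  also have "\<dots> \<le> (\<Sum>e\<in>patterns n. ?w e * ?bad e + ?u e * v e)"
    using w0 v1 by (intro sum_mono) (auto simp: mult_left_le)
  also have "\<dots> = (\<Sum>e\<in>patterns n. ?w e * ?bad e) + (\<Sum>e\<in>patterns n. ?u e * v e)"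
    by (rule sum.distrib)
  also have "(\<Sum>e\<in>patterns n. ?u e * v e) \<le> real K * real (card X) powr (- k)"
  proof -
    have "(\<Sum>e\<in>patterns n. ?u e * v e)
        \<le> (\<Sum>e\<in>patterns n. ?u e * ((\<Sum>m<K. \<Sum>m'<m. of_bool (\<forall>j\<in>survivors n e. f m j = f m' j)) / K))"
      using w0 v2 by (intro sum_mono mult_left_mono mult_nonneg_nonneg) auto
    also have "\<dots> = (\<Sum>e\<in>patterns n. \<Sum>m<K. \<Sum>m'<m. ?u e * of_bool (\<forall>j\<in>survivors n e. f m j = f m' j)) / K"
      by (simp only: sum_distrib_left sum_divide_distrib times_divide_eq_right)
    also have "(\<Sum>e\<in>patterns n. \<Sum>m<K. \<Sum>m'<m. ?u e * of_bool (\<forall>j\<in>survivors n e. f m j = f m' j))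
        = (\<Sum>m<K. \<Sum>e\<in>patterns n. \<Sum>m'<m. ?u e * of_bool (\<forall>j\<in>survivors n e. f m j = f m' j))"
      by (rule sum.swap)
    also have "\<dots> = (\<Sum>m<K. \<Sum>m'<m. \<Sum>e\<in>patterns n. ?u e * of_bool (\<forall>j\<in>survivors n e. f m j = f m' j))"
      by (intro sum.cong refl sum.swap)
    also have "\<dots> / K \<le> real K * real K * (\<Sum>e\<in>patterns n. ?u e / real (card X) ^ card (survivors n e)) / K"
      using cost by (rule divide_right_mono) simp
    also have "\<dots> = real K * (\<Sum>e\<in>patterns n. ?u e / real (card X) ^ card (survivors n e))"
      using K by simp
    also have "\<dots> \<le> real K * (\<Sum>e\<in>patterns n. ?w e * real (card X) powr (- k))"
    proof (intro mult_left_mono sum_mono)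
      fix e
      show "?u e / real (card X) ^ card (survivors n e) \<le> ?w e * real (card X) powr (- k)"
      proof (cases "real (card (survivors n e)) < k")
        case False
        have "1 / real (card X) ^ card (survivors n e) = real (card X) powr (- real (card (survivors n e)))"
          using x by (simp add: powr_minus powr_realpow divide_inverse)
        also have "\<dots> \<le> real (card X) powr (- k)"
          using x False by (intro powr_mono) auto
        finally have "?w e * (1 / real (card X) ^ card (survivors n e)) \<le> ?w e * real (card X) powr (- k)"
          using w0 by (intro mult_left_mono)
        then show ?thesis using False by simp
      qed (use w0 in simp)
    qed simp
    also have "\<dots> = real K * real (card X) powr (- k)"
      by (simp add: sum_distrib_right[symmetric] w1)
    finally show ?thesis .
  qed
  finally have "error_prob p FA FS n {..<K} f ?g
      \<le> (\<Sum>e\<in>patterns n. ?w e * ?bad e) + real K * real (card X) powr (- k)" by simp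
  with f show ?thesis by (rule that)
qed


lemma rate_achievable:
  fixes X :: "'x set"
  assumes X: "finite X" "2 \<le> card X"
  shows "achievable informed X p FA FS (l * survival * log 2 (card X))"
  unfolding achievable_def
proof (intro ballI allI impI)
  fix \<epsilon> \<delta> :: real
  assume "\<epsilon> \<in> {0<..<1}" and \<delta>: "0 < \<delta>"
  then have \<epsilon>: "0 < \<epsilon>" by simp
  have X0: "X \<noteq> {}" using X by auto
  define x where "x = real (card X)"
  have x: "2 \<le> x" using X by (simp add: x_def)
  define L where "L = log 2 x"
  have L: "0 < L" using x by (simp add: L_def)
  \<comment> \<open>The rate to be exceeded. It is negative for large \<open>\<delta>\<close>, hence
    the absolute values below.\<close>
  define D where "D = l * survival * L - \<delta>"
  \<comment> \<open>The first bound keeps \<open>q\<close> positive; the second makes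
    \<open>3 * \<gamma> * l * L < \<delta>\<close>, so that \<open>D / l < L * q\<close>.\<close>
  define \<gamma> where "\<gamma> = min (survival / 4) (\<delta> / (4 * (l * L)))"
  have \<gamma>: "0 < \<gamma>" using survival_pos \<delta> l L by (simp add: \<gamma>_def)
  \<comment> \<open>One \<open>\<gamma>\<close> below the survivor threshold
    \<open>survival - 2 * \<gamma>\<close>: the gap leaves a collision term of at most
    \<open>x powr (- (n * \<gamma>))\<close>.\<close>
  define q where "q = survival - 3 * \<gamma>"
  have q: "0 < q"
  proof -
    have "\<gamma> \<le> survival / 4" by (simp add: \<gamma>_def)
    then show ?thesis using survival_pos unfolding q_def by linarith
  qed
  have Dq: "D / l < L * q"
  proof -
    have "\<gamma> \<le> \<delta> / (4 * (l * L))" by (simp add: \<gamma>_def)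
    then have "4 * (l * L) * \<gamma> \<le> \<delta>" using l L by (simp add: field_simps)
    moreover have "0 < l * L * \<gamma>" using l L \<gamma> by simp
    ultimately have "D < l * (L * q)" by (simp add: D_def q_def algebra_simps)
    then show ?thesis using l by (simp add: field_simps)
  qed
  \<comment> \<open>Waiting may use up half of the rate slack \<open>L * q - D / l\<close>; the
    added 1 avoids dividing by 0.\<close>
  define \<theta> where "\<theta> = (L * q - D / l) / (2 * (\<bar>D\<bar> + 1))"
  have \<theta>: "0 < \<theta>" using Dq by (simp add: \<theta>_def)
  have slope: "\<bar>D\<bar> * \<theta> < L * q - D / l"
  proof -
    have "\<bar>D\<bar> * \<theta> \<le> (\<bar>D\<bar> + 1) * \<theta>" using \<theta> by simp
    also have "\<dots> = (L * q - D / l) / 2"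
    proof -
      have "\<bar>D\<bar> + 1 \<noteq> 0" by linarith
      then show ?thesis unfolding \<theta>_def by (simp only: times_divide_eq_right nonzero_mult_divide_mult_cancel_left mult.commute[of 2] not_False_eq_True)
    qed
    also have "\<dots> < L * q - D / l" using Dq by simp
    finally show ?thesis .
  qed
  obtain C where C: "0 \<le> C" "\<And>n. integrable P (\<lambda>\<omega>. W \<omega> n)"
    "\<And>n. (\<integral>\<omega>. W \<omega> n \<partial>P) \<le> real n * \<theta> + C"
    using waiting_sublinear[OF \<theta>] by blast
  obtain n0 where n0: "\<And>n. n0 \<le> n \<Longrightarrow>
      (\<Sum>e\<in>patterns n. (\<integral>\<omega>. weight n e \<omega> \<partial>P) * of_bool (real (card (survivors n e)) < real n * (survival - 2 * \<gamma>))) < \<epsilon> / 2"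
    using few_survivors_le[OF \<gamma> half_gt_zero[OF \<epsilon>]] by blast
  obtain n1 :: nat where n1: "- log x (\<epsilon> / 2) / \<gamma> < n1" using reals_Archimedean2 by blast
  \<comment> \<open>Absorbs the constants: \<open>C + 2\<close> from the expected duration, and one
    bit lost in rounding the number of messages.\<close>
  obtain n2 :: nat where n2: "(\<bar>D\<bar> * (C + 2) + 1) / (L * q - D / l - \<bar>D\<bar> * \<theta>) < n2" using reals_Archimedean2 by blast
  have "\<exists>R' T M f g. is_code informed X FA FS n R' T M f g \<and> error_prob p FA FS n M f g < \<epsilon> \<and>
      real n * R' / T > l * survival * log 2 (card X) - \<delta>"
    if n: "n0 \<le> n" "n1 \<le> n" "n2 \<le> n" "1 \<le> n" for n
  proof -
    have n_pos: "0 < real n" using n by simp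
    define K where "K = nat \<lfloor>x powr (real n * q)\<rfloor>"
    have "1 \<le> x powr (real n * q)" using x q by (intro ge_one_powr_ge_zero) auto
    then have floor: "1 \<le> \<lfloor>x powr (real n * q)\<rfloor>" by (simp add: le_floor_iff)
    then have K_real: "real K = of_int \<lfloor>x powr (real n * q)\<rfloor>" by (simp add: K_def)
    have K: "real K \<le> x powr (real n * q)" "x powr (real n * q) / 2 \<le> real K" "0 < K"
      using floor floor_correct[of "x powr (real n * q)"] K_real by linarith+
    \<comment> \<open>The expected completion time plus 1, as \<open>is_code\<close> demands a
      strict inequality.\<close>
    define T where "T = n / l + (\<integral>\<omega>. W \<omega> (n - 1) \<partial>P) + 2"
    have W0: "0 \<le> (\<integral>\<omega>. W \<omega> (n - 1) \<partial>P)" by (intro integral_nonneg_AE AE_I2 waiting_nonneg)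
    have T0: "0 < T" using W0 n_pos l by (simp add: T_def add_nonneg_pos)
    define R' where "R' = log 2 K / n"
    have nR: "real n * R' = log 2 K" using n_pos by (simp add: R'_def)
    obtain f :: "nat \<Rightarrow> nat \<Rightarrow> 'x" where f: "\<forall>m<K. \<forall>j<n. f m j \<in> X"
      and err: "error_prob p FA FS n {..<K} f (\<lambda>y _. least_consistent n K f y)
      \<le> (\<Sum>e\<in>patterns n. (\<integral>\<omega>. weight n e \<omega> \<partial>P) * of_bool (real (card (survivors n e)) < real n * (survival - 2 * \<gamma>)))
        + real K * real (card X) powr (- (real n * (survival - 2 * \<gamma>)))"
      using exists_code_error_le[OF X(1) X0 K(3), of n "real n * (survival - 2 * \<gamma>)"] by blast
    have "is_code informed X FA FS n R' T {..<K} f (\<lambda>y _. least_consistent n K f y)"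
      unfolding is_code_def nR
    proof (intro conjI)
      show "(\<integral>\<^sup>+ (t, s). ennreal (service_start t s (n - 1) + s (n - 1)) \<partial>P) < ennreal T"
        using n W0 l unfolding T_def by (subst completion_time) (auto intro!: ennreal_lessI)
      show "\<forall>y. (\<lambda>_. least_consistent n K f y)
          \<in> (\<Pi>\<^sub>M j\<in>{..<n}. borel) \<Otimes>\<^sub>M (\<Pi>\<^sub>M j\<in>{..<n}. borel) \<rightarrow>\<^sub>M count_space {..<K}"
        using least_consistent_less[OF K(3)] by (intro allI measurable_const) simp
    qed (use n f K in \<open>auto simp: powr_log_cancel\<close>)
    moreover have "error_prob p FA FS n {..<K} f (\<lambda>y _. least_consistent n K f y) < \<epsilon>"
    proof -
      have "real K * x powr (- (real n * (survival - 2 * \<gamma>))) \<le> x powr (real n * q) * x powr (- (real n * (survival - 2 * \<gamma>)))"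
        using K by (intro mult_right_mono) auto
      also have "\<dots> = x powr (- (real n * \<gamma>))"
        by (simp add: powr_add[symmetric] q_def algebra_simps)
      also have "\<dots> \<le> \<epsilon> / 2"
      proof -
        have "- log x (\<epsilon> / 2) / \<gamma> < n" using n1 n by linarith
        then have "- (real n * \<gamma>) < log x (\<epsilon> / 2)" using \<gamma> by (simp add: field_simps)
        then have "x powr (- (real n * \<gamma>)) \<le> x powr log x (\<epsilon> / 2)" using x by (intro powr_mono) auto
        then show ?thesis using x \<epsilon> by simp
      qed
      finally show ?thesis using err n0[OF n(1)] unfolding x_def by linarith
    qed
    moreover have "real n * R' / T > l * survival * log 2 (card X) - \<delta>"
    proof -
      have "real n * (L * q) - 1 \<le> log 2 K"
      proof -
        have "log 2 (x powr (real n * q) / 2) \<le> log 2 K"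
          using K x by (subst log_le_cancel_iff) auto
        moreover have "log 2 (x powr (real n * q) / 2) = real n * (L * q) - 1"
          using x by (simp add: log_divide log_powr L_def)
        ultimately show ?thesis by simp
      qed
      moreover have "D * T < real n * (L * q) - 1"
      proof -
        have "T \<le> n / l + (real n * \<theta> + C) + 2"
        proof -
          have "(\<integral>\<omega>. W \<omega> (n - 1) \<partial>P) \<le> real (n - 1) * \<theta> + C" by (rule C(3))
          also have "\<dots> \<le> real n * \<theta> + C" using \<theta> by (intro add_right_mono mult_right_mono) auto
          finally show ?thesis by (simp add: T_def)
        qed
        then have "T - n / l \<le> real n * \<theta> + C + 2" by simp
        moreover have "0 \<le> T - n / l" using W0 by (simp add: T_def)
        ultimately have "D * (T - n / l) \<le> \<bar>D\<bar> * (real n * \<theta> + C + 2)"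
          by (intro mult_mono) auto
        then have "D * T \<le> real n * (D / l) + \<bar>D\<bar> * (real n * \<theta> + C + 2)"
          by (simp add: algebra_simps)
        moreover have "\<bar>D\<bar> * (C + 2) + 1 < real n * (L * q - D / l - \<bar>D\<bar> * \<theta>)"
        proof -
          have "(\<bar>D\<bar> * (C + 2) + 1) / (L * q - D / l - \<bar>D\<bar> * \<theta>) < n" using n2 n by linarith
          then show ?thesis using slope by (simp add: pos_divide_less_eq)
        qed
        ultimately show ?thesis by (simp add: algebra_simps)
      qed
      ultimately have "D * T < real n * R'" unfolding nR by linarith
      then show ?thesis using T0 by (simp add: D_def L_def x_def pos_less_divide_eq)
    qed
    ultimately show ?thesis by blast
  qed
  then show "\<forall>\<^sub>F n in sequentially. \<exists>R' T M f g. is_code informed X FA FS n R' T M f g \<and>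
      error_prob p FA FS n M f g < \<epsilon> \<and> real n * R' / T > l * survival * log 2 (card X) - \<delta>"
    by (intro eventually_sequentiallyI[of "max (max n0 n1) (max n2 1)"]) auto
qed

text \<open>The supremum is attained: the slack \<open>\<delta>\<close> in \<open>achievable\<close>
  makes the limiting rate itself achievable.\<close>

lemma capacity_eq:
  assumes X: "finite X" "2 \<le> card X"
  shows "capacity informed X p FA FS = ereal (l * survival * log 2 (card X))"
  unfolding capacity_def
proof (rule antisym)
  have "X \<noteq> {}" using X by auto
  then show "(SUP R\<in>{R. achievable informed X p FA FS R}. ereal R) \<le> ereal (l * survival * log 2 (card X))"
    using X by (intro SUP_least) (auto intro: achievable_le)
  show "ereal (l * survival * log 2 (card X)) \<le> (SUP R\<in>{R. achievable informed X p FA FS R}. ereal R)"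
    using rate_achievable[OF X] by (intro SUP_upper) simp
qed

end

section \<open>The optimal arrival rate\<close>

text \<open>A completed square replaces differentiation; the square vanishes exactly when
  \<open>1 - l = l * r\<close>, that is, at \<open>l = 1 / (1 + r)\<close>.\<close>

lemma throughput_le:
  fixes l r :: real
  assumes l: "0 < l" "l < 1" and r: "0 < r"
  shows "l * ((1 - l) / (1 - l * (1 - r\<^sup>2))) \<le> 1 / (1 + r)\<^sup>2"
proof -
  have "0 < (1 - l) + l * r\<^sup>2" using l r by (intro add_pos_pos) auto
  then have pos: "0 < 1 - l * (1 - r\<^sup>2)" by (simp add: algebra_simps)
  have "(1 - l * (1 - r\<^sup>2)) - l * (1 - l) * (1 + r)\<^sup>2 = ((1 - l) - l * r)\<^sup>2"
    by (simp add: power2_eq_square algebra_simps)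
  then have "l * (1 - l) * (1 + r)\<^sup>2 \<le> 1 - l * (1 - r\<^sup>2)"
    using zero_le_power2[of "(1 - l) - l * r"] by linarith
  then show ?thesis using pos r by (simp add: field_simps)
qed

theorem theorem3:
  fixes \<kappa> :: real and FS :: "real measure" and X :: "'x set" and informed :: bool
  assumes "\<kappa> > 0"
    and "real_distribution FS"
    and "cdf FS 0 = 0"
    and "has_bochner_integral FS (\<lambda>x. x) 1"
    and "finite X" and "card X \<ge> 2"
  shows "let \<alpha> = (1 - laplace_transform FS \<kappa>) / \<kappa> in
    is_arg_max
      (\<lambda>l. capacity informed X (\<lambda>w. 1 - exp (- \<kappa> * w)) (exponential_distribution l) FS)
      (\<lambda>l. l \<in> {0<..<1})
      (1 / \<alpha> * (1 - sqrt (1 - \<alpha>)))"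
proof -
  interpret FS: real_distribution FS by fact
  define \<alpha> where "\<alpha> = (1 - laplace_transform FS \<kappa>) / \<kappa>"
  define r where "r = sqrt (1 - \<alpha>)"
  define c where "c = log 2 (card X)"
  have c: "0 < c" using assms by (simp add: c_def)
  \<comment> \<open>Service times are almost surely strictly positive. This makes both inequalities
    \<open>0 < \<alpha> < 1\<close> strict, so that \<open>r\<close> lies strictly between 0 and
    1.\<close>
  have "{..0} \<in> null_sets FS"
    using \<open>cdf FS 0 = 0\<close> by (intro null_setsI) (simp_all add: cdf_def FS.emeasure_eq_measure)
  then have pos: "AE y in FS. 0 < y"
    by (rule AE_not_in[THEN eventually_mono]) (simp add: not_le)
  then have nonneg: "AE y in FS. 0 \<le> y" by (rule eventually_mono) simp
  have queue: "queue l \<kappa> FS" if "0 < l" "l < 1" for l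
    using that assms nonneg by unfold_locales
  have cap: "capacity informed X (\<lambda>w. 1 - exp (- \<kappa> * w)) (exponential_distribution l) FS
      = ereal (l * ((1 - l) / (1 - l * \<alpha>)) * c)" if "0 < l" "l < 1" for l
  proof -
    interpret queue l \<kappa> FS by (rule queue[OF that])
    have "1 - laplace = \<kappa> * \<alpha>"
      using \<open>\<kappa> > 0\<close> by (simp add: \<alpha>_def)
    then have "drift = \<kappa> * (1 - l * \<alpha>)"
      by (simp only: drift_def) (simp only: right_diff_distrib mult_1_right mult.left_commute)
    then have "survival = (1 - l) / (1 - l * \<alpha>)"
      using \<open>\<kappa> > 0\<close> by (simp add: survival_def)
    then show ?thesis
      using capacity_eq[OF assms(5,6), of informed] by (simp add: c_def)
  qed
  have \<alpha>: "0 < \<alpha>" "\<alpha> < 1"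
  proof -
    have exp_int: "integrable FS (\<lambda>y. exp (- \<kappa> * y))"
      by (rule FS.integrable_const_bound[where B = 1]) (use nonneg \<open>\<kappa> > 0\<close> in auto)
    have mean: "integrable FS (\<lambda>y. y)" "(\<integral>y. y \<partial>FS) = 1"
      using assms(4) by (auto simp: has_bochner_integral_iff)
    have "laplace_transform FS \<kappa> < 1"
      unfolding laplace_transform_def
      using pos \<open>\<kappa> > 0\<close> by (intro FS.expectation_less exp_int) auto
    then show "0 < \<alpha>" using \<open>\<kappa> > 0\<close> by (simp add: \<alpha>_def)
    have "(\<integral>y. 1 - \<kappa> * y - exp (- \<kappa> * y) \<partial>FS) < 0"
    proof (rule FS.expectation_less)
      show "integrable FS (\<lambda>y. 1 - \<kappa> * y - exp (- \<kappa> * y))"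
        using exp_int mean by simp
      show "AE y in FS. 1 - \<kappa> * y - exp (- \<kappa> * y) < 0"
        using pos
      proof eventually_elim
        case (elim y)
        \<comment> \<open>The strict form of \<open>1 - u < exp (- u)\<close> at
          \<open>u = \<kappa> * y > 0\<close>, obtained from the equality case of
          \<open>ln z \<le> z - 1\<close>.\<close>
        have "- \<kappa> * y \<le> exp (- \<kappa> * y) - 1"
          using ln_le_minus_one[of "exp (- \<kappa> * y)"] by simp
        moreover have "- \<kappa> * y \<noteq> exp (- \<kappa> * y) - 1"
          using ln_eq_minus_one[of "exp (- \<kappa> * y)"] elim \<open>\<kappa> > 0\<close> by auto
        ultimately show ?case by simp
      qed
    qed
    also have "(\<integral>y. 1 - \<kappa> * y - exp (- \<kappa> * y) \<partial>FS) = 1 - \<kappa> - laplace_transform FS \<kappa>"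
      using exp_int mean FS.prob_space by (simp add: laplace_transform_def)
    finally show "\<alpha> < 1" using \<open>\<kappa> > 0\<close> by (simp add: \<alpha>_def)
  qed
  then have r: "0 < r" "r < 1" "\<alpha> = 1 - r\<^sup>2"
    by (simp_all add: r_def)
  have "1 / \<alpha> * (1 - sqrt (1 - \<alpha>)) = 1 / \<alpha> * (1 - r)"
    by (simp only: r_def)
  also have "\<dots> = (1 - r) / ((1 - r) * (1 + r))"
    unfolding r(3) by (simp add: power2_eq_square algebra_simps)
  also have "\<dots> = 1 / (1 + r)" using r by simp
  finally have opt: "1 / \<alpha> * (1 - sqrt (1 - \<alpha>)) = 1 / (1 + r)" .
  have opt_val: "1 / (1 + r) * ((1 - 1 / (1 + r)) / (1 - 1 / (1 + r) * \<alpha>)) = 1 / (1 + r)\<^sup>2"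
  proof -
    have "1 - 1 / (1 + r) = r / (1 + r)" using r by (simp add: field_simps)
    moreover have "1 - 1 / (1 + r) * \<alpha> = r"
      using r(1) unfolding r(3) by (simp add: field_simps power2_eq_square)
    ultimately show ?thesis using r(1) by (simp add: power2_eq_square)
  qed
  show ?thesis
    unfolding Let_def \<alpha>_def[symmetric] opt is_arg_max_def
  proof (intro conjI notI)
    show opt_mem: "1 / (1 + r) \<in> {0<..<1}" using r by simp
    assume "\<exists>l. l \<in> {0<..<1} \<and> capacity informed X (\<lambda>w. 1 - exp (- \<kappa> * w)) (exponential_distribution (1 / (1 + r))) FS
      < capacity informed X (\<lambda>w. 1 - exp (- \<kappa> * w)) (exponential_distribution l) FS"
    then obtain l where l_mem: "l \<in> {0<..<1}"
      and better: "capacity informed X (\<lambda>w. 1 - exp (- \<kappa> * w)) (exponential_distribution (1 / (1 + r))) FS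
        < capacity informed X (\<lambda>w. 1 - exp (- \<kappa> * w)) (exponential_distribution l) FS"
      by (elim exE conjE)
    from l_mem have l: "0 < l" "l < 1" by simp_all
    have "0 < 1 / (1 + r)" "1 / (1 + r) < 1" using opt_mem by simp_all
    from better[unfolded cap[OF l] cap[OF this] opt_val]
    have "1 / (1 + r)\<^sup>2 * c < l * ((1 - l) / (1 - l * \<alpha>)) * c"
      by (simp only: less_ereal.simps)
    then have "1 / (1 + r)\<^sup>2 < l * ((1 - l) / (1 - l * \<alpha>))"
      using c by (simp only: mult_less_cancel_right_pos)
    with throughput_le[OF l r(1)] show False unfolding r(3) by linarith
  qed
qed

end
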